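(* Let $k$ be a field of characteristic zero and let $A$ be a reduced commutative $k$-algebra (not assumed to be noetherian). If the module of Kähler differentials $\Omega_{A/k}=0$, then $A$ is ind-étale over $k$.
   Context: All rings are commutative and unital. A finite type $k$-algebra $R$ is called étale over $k$ if $\Omega_{R/k}=0$. A $k$-algebra is called ind-étale if, as a $k$-algebra, it is isomorphic to a direct limit of some direct system (indexed by a directed set) of étale $k$-algebras. *)

theory Defs
  imports "HOL-Algebra.Module" "HOL-Algebra.QuotRing" "HOL-Algebra.Generated_Rings"
begin

text \<open>
  Commutative unital algebras over \<open>k\<close> are those of the locale \<^locale>\<open>algebra\<close>; the zero ring is
  allowed. The structure map \<open>k \<rightarrow> A\<close> is \<open>c \<mapsto> c \<odot>\<^bsub>A\<^esub> \<one>\<^bsub>A\<^esub>\<close>.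
\<close>

definition char_zero :: "('k, 'm) ring_scheme \<Rightarrow> bool" where
  "char_zero k \<longleftrightarrow> (\<forall>n::nat. [n] \<cdot>\<^bsub>k\<^esub> \<one>\<^bsub>k\<^esub> = \<zero>\<^bsub>k\<^esub> \<longrightarrow> n = 0)"

definition reduced :: "('a, 'm) ring_scheme \<Rightarrow> bool" where
  "reduced A \<longleftrightarrow> (\<forall>x\<in>carrier A. \<forall>n::nat. x [^]\<^bsub>A\<^esub> n = \<zero>\<^bsub>A\<^esub> \<longrightarrow> x = \<zero>\<^bsub>A\<^esub>)"


section \<open>Kaehler differentials\<close>

text \<open>
  In the module records below the fields \<^const>\<open>mult\<close> and \<^const>\<open>one\<close> play no role
  (\<^locale>\<open>module\<close> does not look at them) and are left unspecified.
\<close>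

definition free_module :: "('a, 'm) ring_scheme \<Rightarrow> 'b set \<Rightarrow> ('a, 'b \<Rightarrow> 'a) module" where
  "free_module A U =
    \<lparr>carrier = {f. (\<forall>x\<in>U. f x \<in> carrier A) \<and> (\<forall>x. x \<notin> U \<longrightarrow> f x = \<zero>\<^bsub>A\<^esub>)
                 \<and> finite {x. f x \<noteq> \<zero>\<^bsub>A\<^esub>}},
     mult = undefined, one = undefined,
     zero = (\<lambda>x. \<zero>\<^bsub>A\<^esub>), add = (\<lambda>f g x. f x \<oplus>\<^bsub>A\<^esub> g x),
     smult = (\<lambda>a f x. a \<otimes>\<^bsub>A\<^esub> f x)\<rparr>"

definition basis_elt :: "('a, 'm) ring_scheme \<Rightarrow> 'x \<Rightarrow> 'x \<Rightarrow> 'a" where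
  "basis_elt A x = (\<lambda>y. if y = x then \<one>\<^bsub>A\<^esub> else \<zero>\<^bsub>A\<^esub>)"

definition span_submodule ::
  "('a, 'm) ring_scheme \<Rightarrow> ('a, 'b, 'n) module_scheme \<Rightarrow> 'b set \<Rightarrow> 'b set" where
  "span_submodule R M S = (\<lambda>N. submodule N R M) hull S"

definition quotient_module :: "('a, 'b, 'n) module_scheme \<Rightarrow> 'b set \<Rightarrow> ('a, 'b set) module" where
  "quotient_module M N =
    \<lparr>carrier = a_rcosets\<^bsub>M\<^esub> N,
     mult = undefined, one = undefined,
     zero = N, add = set_add M,
     smult = (\<lambda>a U. \<Union>x\<in>U. N +>\<^bsub>M\<^esub> (a \<odot>\<^bsub>M\<^esub> x))\<rparr>"

text \<open>
  \<open>\<Omega>\<^bsub>A/k\<^esub>\<close> is the free \<open>A\<close>-module on the symbols \<open>d a\<close> (\<open>a \<in> A\<close>) modulo the relations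
  \<open>d (a + b) = d a + d b\<close>, \<open>d (a b) = a d b + b d a\<close>, and \<open>d c = 0\<close> for \<open>c\<close> in the image of \<open>k\<close>.
\<close>

definition kaehler_relations ::
  "('k, 'm) ring_scheme \<Rightarrow> ('k, 'a, 'n) module_scheme \<Rightarrow> ('a \<Rightarrow> 'a) set" where
  "kaehler_relations k A =
    (let F = free_module A (carrier A); d = basis_elt A in
      {d (a \<oplus>\<^bsub>A\<^esub> b) \<ominus>\<^bsub>F\<^esub> (d a \<oplus>\<^bsub>F\<^esub> d b) | a b. a \<in> carrier A \<and> b \<in> carrier A} \<union>
      {d (a \<otimes>\<^bsub>A\<^esub> b) \<ominus>\<^bsub>F\<^esub> (a \<odot>\<^bsub>F\<^esub> d b \<oplus>\<^bsub>F\<^esub> b \<odot>\<^bsub>F\<^esub> d a) | a b. a \<in> carrier A \<and> b \<in> carrier A} \<union>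
      {d (c \<odot>\<^bsub>A\<^esub> \<one>\<^bsub>A\<^esub>) | c. c \<in> carrier k})"

definition kaehler_differentials ::
  "('k, 'm) ring_scheme \<Rightarrow> ('k, 'a, 'n) module_scheme \<Rightarrow> ('a, ('a \<Rightarrow> 'a) set) module" where
  "kaehler_differentials k A =
    (let F = free_module A (carrier A)
     in quotient_module F (span_submodule A F (kaehler_relations k A)))"

definition zero_module :: "('a, 'b, 'n) module_scheme \<Rightarrow> bool" where
  "zero_module M \<longleftrightarrow> carrier M = {\<zero>\<^bsub>M\<^esub>}"


section \<open>Etale algebras\<close>

text \<open>The \<open>k\<close>-subalgebra generated by \<open>S\<close> is the subring generated by \<open>S\<close> and the image of \<open>k\<close>.\<close>

definition finite_type :: "('k, 'm) ring_scheme \<Rightarrow> ('k, 'a, 'n) module_scheme \<Rightarrow> bool" where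
  "finite_type k A \<longleftrightarrow>
    (\<exists>S. finite S \<and> S \<subseteq> carrier A \<and>
      generate_ring A ((\<lambda>c. c \<odot>\<^bsub>A\<^esub> \<one>\<^bsub>A\<^esub>) ` carrier k \<union> S) = carrier A)"

definition etale :: "('k, 'm) ring_scheme \<Rightarrow> ('k, 'a, 'n) module_scheme \<Rightarrow> bool" where
  "etale k A \<longleftrightarrow> algebra k A \<and> finite_type k A \<and> zero_module (kaehler_differentials k A)"


section \<open>Direct limits of algebras\<close>

definition algebra_hom ::
  "('k, 'm) ring_scheme \<Rightarrow> ('k, 'a, 'n) module_scheme \<Rightarrow> ('k, 'b, 'p) module_scheme \<Rightarrow> ('a \<Rightarrow> 'b) set"
  where "algebra_hom k A B =
    {h \<in> ring_hom A B. \<forall>c\<in>carrier k. \<forall>x\<in>carrier A. h (c \<odot>\<^bsub>A\<^esub> x) = c \<odot>\<^bsub>B\<^esub> h x}"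

definition algebra_iso ::
  "('k, 'm) ring_scheme \<Rightarrow> ('k, 'a, 'n) module_scheme \<Rightarrow> ('k, 'b, 'p) module_scheme \<Rightarrow> ('a \<Rightarrow> 'b) set"
  where "algebra_iso k A B = {h \<in> algebra_hom k A B. bij_betw h (carrier A) (carrier B)}"

definition directed_set :: "'i set \<Rightarrow> 'i rel \<Rightarrow> bool" where
  "directed_set I r \<longleftrightarrow>
    preorder_on I r \<and> I \<noteq> {} \<and> (\<forall>i\<in>I. \<forall>j\<in>I. \<exists>l\<in>I. (i, l) \<in> r \<and> (j, l) \<in> r)"

locale direct_system =
  fixes k :: "('k, 'm) ring_scheme" and I :: "'i set" and r :: "'i rel"
    and R :: "'i \<Rightarrow> ('k, 'r) module" and \<phi> :: "'i \<Rightarrow> 'i \<Rightarrow> 'r \<Rightarrow> 'r"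
  assumes directed: "directed_set I r"
    and algebra: "i \<in> I \<Longrightarrow> algebra k (R i)"
    and transition: "(i, j) \<in> r \<Longrightarrow> \<phi> i j \<in> algebra_hom k (R i) (R j)"
    and transition_refl: "i \<in> I \<Longrightarrow> x \<in> carrier (R i) \<Longrightarrow> \<phi> i i x = x"
    and transition_comp:
      "(i, j) \<in> r \<Longrightarrow> (j, l) \<in> r \<Longrightarrow> x \<in> carrier (R i) \<Longrightarrow> \<phi> j l (\<phi> i j x) = \<phi> i l x"

text \<open>
  The direct limit is the disjoint union of the \<open>R i\<close>, in which \<open>(i, x)\<close> and \<open>(j, y)\<close> are
  identified when \<open>x\<close> and \<open>y\<close> have the same image in some \<open>R l\<close> with \<open>i, j \<le> l\<close>.
  Classes are added and multiplied by moving representatives to a common \<open>R l\<close>.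
\<close>

definition limit_rel ::
  "'i set \<Rightarrow> 'i rel \<Rightarrow> ('i \<Rightarrow> ('k, 'r) module) \<Rightarrow> ('i \<Rightarrow> 'i \<Rightarrow> 'r \<Rightarrow> 'r) \<Rightarrow> ('i \<times> 'r) rel" where
  "limit_rel I r R \<phi> =
    {((i, x), (j, y)). i \<in> I \<and> x \<in> carrier (R i) \<and> j \<in> I \<and> y \<in> carrier (R j) \<and>
       (\<exists>l. (i, l) \<in> r \<and> (j, l) \<in> r \<and> \<phi> i l x = \<phi> j l y)}"

definition limit_op ::
  "'i set \<Rightarrow> 'i rel \<Rightarrow> ('i \<Rightarrow> ('k, 'r) module) \<Rightarrow> ('i \<Rightarrow> 'i \<Rightarrow> 'r \<Rightarrow> 'r) \<Rightarrow>
    ('i \<Rightarrow> 'r \<Rightarrow> 'r \<Rightarrow> 'r) \<Rightarrow> ('i \<times> 'r) set \<Rightarrow> ('i \<times> 'r) set \<Rightarrow> ('i \<times> 'r) set" where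
  "limit_op I r R \<phi> f U V =
    limit_rel I r R \<phi> ``
      {(l, f l (\<phi> i l x) (\<phi> j l y)) | i x j y l.
         (i, x) \<in> U \<and> (j, y) \<in> V \<and> (i, l) \<in> r \<and> (j, l) \<in> r}"

definition direct_limit ::
  "'i set \<Rightarrow> 'i rel \<Rightarrow> ('i \<Rightarrow> ('k, 'r) module) \<Rightarrow> ('i \<Rightarrow> 'i \<Rightarrow> 'r \<Rightarrow> 'r) \<Rightarrow>
    ('k, ('i \<times> 'r) set) module" where
  "direct_limit I r R \<phi> =
    \<lparr>carrier = (SIGMA i:I. carrier (R i)) // limit_rel I r R \<phi>,
     mult = limit_op I r R \<phi> (\<lambda>l. mult (R l)),
     one = limit_rel I r R \<phi> `` {(i, \<one>\<^bsub>R i\<^esub>) | i. i \<in> I},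
     zero = limit_rel I r R \<phi> `` {(i, \<zero>\<^bsub>R i\<^esub>) | i. i \<in> I},
     add = limit_op I r R \<phi> (\<lambda>l. add (R l)),
     smult = (\<lambda>c U. limit_rel I r R \<phi> `` {(i, c \<odot>\<^bsub>R i\<^esub> x) | i x. (i, x) \<in> U})\<rparr>"

text \<open>
  HOL cannot quantify over the types in which the index set and the algebras of a direct system
  live, so they are parameters. A direct system over any choice of these types shows that \<open>A\<close> is
  ind-etale.
\<close>

definition ind_etale ::
  "'i itself \<Rightarrow> 'r itself \<Rightarrow> ('k, 'm) ring_scheme \<Rightarrow> ('k, 'a, 'n) module_scheme \<Rightarrow> bool" where
  "ind_etale _ _ k A \<longleftrightarrow>
    (\<exists>(I :: 'i set) (r :: 'i rel) (R :: 'i \<Rightarrow> ('k, 'r) module) \<phi>.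
       direct_system k I r R \<phi> \<and> (\<forall>i\<in>I. etale k (R i)) \<and>
       algebra_iso k A (direct_limit I r R \<phi>) \<noteq> {})"

end

(* The subalgebras of A that are generated by finitely many elements form a directed system with
   union A, so it suffices that each of them is etale.

   First, A is integral over k.  If a is not, the monic polynomials in a form a multiplicative set
   without 0, and a prime ideal P avoiding it makes a transcendental in the domain D = A/P.
   Adjoining elements to k[a] one at a time, in characteristic zero the derivation d/da extends, up
   to a nonzero factor, to every finitely generated subring of D; a fraction field is not needed.
   As d a = 0 in Omega involves only finitely many relations, this is a contradiction.

   Second, a reduced algebra B integral over a field of characteristic zero has Omega = 0: every
   element q satisfies q = q^2 r for some r, hence the ideal of f'(b) is generated by an idempotent,
   and an induction on the degree of f gives w db = 0 whenever w f(b) = 0 with w idempotent. *)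

theory Submission
  imports Defs
begin

section \<open>Polynomials as coefficient lists\<close>

text \<open>The obstacle is that vanishing of Omega does not visibly pass from A to a finitely
  generated subalgebra B: the relations behind d b = 0 may use elements outside B. Integrality does
  pass to B, because a monic relation has its coefficients in the image of k. So integrality is
  extracted from Omega = 0 on A, and Omega = 0 is rebuilt from it on each B. The factor in the
  extension of d/da comes from f'(x), with f a shortest relation of the new element x. An extended
  derivation delta must satisfy f^delta(x) + f'(x) delta(x) = 0, where f^delta has delta applied to
  the coefficients; replacing delta by f'(x) delta avoids the division. Such factors accumulate, so
  one derivation serves only finitely many elements, which is why the finiteness of the relations
  matters. Derivations are subrings of the dual numbers, so the extension step and the chain rule in
  Omega come from one evaluation formula. Characteristic zero makes the derivative of a relation
  keep a nonzero, or invertible, leading coefficient.\<close>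

text \<open>Coefficients are listed from the constant term upwards; leading zeros are allowed.\<close>

fun peval :: "('a, 'm) ring_scheme \<Rightarrow> 'a list \<Rightarrow> 'a \<Rightarrow> 'a" where
  "peval R [] x = \<zero>\<^bsub>R\<^esub>"
| "peval R (c # p) x = c \<oplus>\<^bsub>R\<^esub> x \<otimes>\<^bsub>R\<^esub> peval R p x"

fun padd :: "('a, 'm) ring_scheme \<Rightarrow> 'a list \<Rightarrow> 'a list \<Rightarrow> 'a list" where
  "padd R [] q = q"
| "padd R (a # p) [] = a # p"
| "padd R (a # p) (b # q) = (a \<oplus>\<^bsub>R\<^esub> b) # padd R p q"

text \<open>The recursion is (c + x p)' = p + x p', so no integer multiples are formed. The separate
  clause for \<open>[c]\<close> avoids a spurious zero coefficient: a nonempty list becomes exactly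
  one shorter, which the later degree arguments use.\<close>

fun pderiv :: "('a, 'm) ring_scheme \<Rightarrow> 'a list \<Rightarrow> 'a list" where
  "pderiv R [] = []"
| "pderiv R [c] = []"
| "pderiv R (c # d # p) = padd R (d # p) (\<zero>\<^bsub>R\<^esub> # pderiv R (d # p))"

lemma length_padd [simp]: "length (padd R p q) = max (length p) (length q)"
  by (induction R p q rule: padd.induct) auto

lemma length_pderiv [simp]: "length (pderiv R p) = length p - 1"
  by (induction R p rule: pderiv.induct) auto

lemma padd_eq_Nil_iff [simp]: "padd R p q = [] \<longleftrightarrow> p = [] \<and> q = []"
  by (cases p; cases q) auto

lemma last_padd_longer: "length p < length q \<Longrightarrow> last (padd R p q) = last q"
  by (induction R p q rule: padd.induct) auto

lemma last_padd_same_length: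
  "length p = length q \<Longrightarrow> p \<noteq> [] \<Longrightarrow> last (padd R p q) = last p \<oplus>\<^bsub>R\<^esub> last q"
  by (induction R p q rule: padd.induct) auto

context cring
begin

lemma peval_closed [simp, intro]:
  "set p \<subseteq> carrier R \<Longrightarrow> x \<in> carrier R \<Longrightarrow> peval R p x \<in> carrier R"
  by (induction p) auto

lemma peval_in_subring:
  assumes "subring H R" "set p \<subseteq> H" "x \<in> H"
  shows "peval R p x \<in> H"
  using assms(2) by (induction p) (auto intro!: subringE[OF assms(1)] simp: assms(3))

lemma set_padd_subring:
  assumes "subring H R" "set p \<subseteq> H" "set q \<subseteq> H"
  shows "set (padd R p q) \<subseteq> H"
  using assms(2,3)
  by (induction p q rule: list_induct2') (auto simp: subringE[OF assms(1)])

lemma peval_padd: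
  assumes "set p \<subseteq> carrier R" "set q \<subseteq> carrier R" "x \<in> carrier R"
  shows "peval R (padd R p q) x = peval R p x \<oplus> peval R q x"
  using assms
proof (induction p q rule: list_induct2')
  case (4 a p b q)
  have "peval R p x \<in> carrier R" "peval R q x \<in> carrier R" using 4 by auto
  then show ?case using 4 by (simp, algebra)
qed auto

lemma peval_append:
  assumes "set p \<subseteq> carrier R" "set q \<subseteq> carrier R" "x \<in> carrier R"
  shows "peval R (p @ q) x = peval R p x \<oplus> x [^] length p \<otimes> peval R q x"
  using assms
proof (induction p)
  case (Cons c p)
  have "peval R p x \<in> carrier R" "peval R q x \<in> carrier R" using Cons by auto
  then show ?case using Cons
    by (simp add: r_distr a_assoc m_ac)
qed auto

lemma peval_smult:
  assumes "set p \<subseteq> carrier R" "c \<in> carrier R" "x \<in> carrier R"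
  shows "peval R (map (\<lambda>a. c \<otimes> a) p) x = c \<otimes> peval R p x"
  using assms
proof (induction p)
  case (Cons a p)
  have "peval R p x \<in> carrier R" using Cons by auto
  then show ?case using Cons by (simp, algebra)
qed auto

lemma peval_replicate_zero:
  assumes "x \<in> carrier R"
  shows "peval R (replicate n \<zero>) x = \<zero>"
  by (induction n) (auto simp: assms)

lemma set_pderiv_subring:
  assumes "subring H R" "set p \<subseteq> H"
  shows "set (pderiv R p) \<subseteq> H"
  using assms(2)
proof (induction p rule: induct_list012)
  case (3 c d p)
  then have "set (pderiv R (d # p)) \<subseteq> H" by simp
  then show ?case
    using 3(3) set_padd_subring[OF assms(1), of "d # p" "\<zero> # pderiv R (d # p)"] subringE(2)[OF assms(1)]
    by simp
qed auto

lemma last_pderiv: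
  assumes "set p \<subseteq> carrier R" "length p \<ge> 2"
  shows "last (pderiv R p) = [(length p - 1)] \<cdot> (last p)"
  using assms
proof (induction p rule: induct_list012)
  case (3 c d p)
  show ?case
  proof (cases "p = []")
    case True
    then show ?thesis using 3 by simp
  next
    case False
    then have ne: "pderiv R (d # p) \<noteq> []" by (cases p) auto
    have "last (pderiv R (d # p)) = [(length p)] \<cdot> (last p)"
      using 3 False by (cases p) auto
    moreover have "last p \<in> carrier R" using 3 False by auto
    ultimately show ?thesis
      using ne False by (simp add: last_padd_same_length a_comm)
  qed
qed auto

text \<open>In product form, a degree that is nonzero in a domain, or a unit, passes this property
  on to the leading coefficient of the derivative.\<close>

lemma last_pderiv_mult:
  assumes "set p \<subseteq> carrier R" "length p \<ge> 2"
  shows "last (pderiv R p) = ([(length p - 1)] \<cdot> \<one>) \<otimes> last p"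
proof -
  have "p \<noteq> []" using assms(2) by auto
  then have "last p \<in> carrier R" using assms(1) by auto
  then show ?thesis
    using last_pderiv[OF assms] add_pow_ldistr[of \<one> "last p" "length p - 1"] by simp
qed

end

section \<open>Dual numbers\<close>

text \<open>The ring R[e]/(e^2), with (a, a') standing for a + a' e. The second component of a
  product is the Leibniz rule.\<close>

definition dual :: "('a, 'm) ring_scheme \<Rightarrow> ('a \<times> 'a) ring" where
  "dual R = \<lparr>carrier = carrier R \<times> carrier R,
     mult = (\<lambda>(a, a') (b, b'). (a \<otimes>\<^bsub>R\<^esub> b, a \<otimes>\<^bsub>R\<^esub> b' \<oplus>\<^bsub>R\<^esub> b \<otimes>\<^bsub>R\<^esub> a')),
     one = (\<one>\<^bsub>R\<^esub>, \<zero>\<^bsub>R\<^esub>), zero = (\<zero>\<^bsub>R\<^esub>, \<zero>\<^bsub>R\<^esub>),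
     add = (\<lambda>(a, a') (b, b'). (a \<oplus>\<^bsub>R\<^esub> b, a' \<oplus>\<^bsub>R\<^esub> b'))\<rparr>"

lemma dual_simps [simp]:
  "carrier (dual R) = carrier R \<times> carrier R"
  "(a, a') \<otimes>\<^bsub>dual R\<^esub> (b, b') = (a \<otimes>\<^bsub>R\<^esub> b, a \<otimes>\<^bsub>R\<^esub> b' \<oplus>\<^bsub>R\<^esub> b \<otimes>\<^bsub>R\<^esub> a')"
  "(a, a') \<oplus>\<^bsub>dual R\<^esub> (b, b') = (a \<oplus>\<^bsub>R\<^esub> b, a' \<oplus>\<^bsub>R\<^esub> b')"
  "\<one>\<^bsub>dual R\<^esub> = (\<one>\<^bsub>R\<^esub>, \<zero>\<^bsub>R\<^esub>)"
  "\<zero>\<^bsub>dual R\<^esub> = (\<zero>\<^bsub>R\<^esub>, \<zero>\<^bsub>R\<^esub>)"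
  by (auto simp: dual_def)

context cring
begin

lemma dual_cring: "cring (dual R)"
proof (rule cringI)
  show "abelian_group (dual R)"
  proof (rule abelian_groupI)
    fix x assume "x \<in> carrier (dual R)"
    then show "\<exists>y\<in>carrier (dual R). y \<oplus>\<^bsub>dual R\<^esub> x = \<zero>\<^bsub>dual R\<^esub>"
      by (intro bexI[of _ "(\<ominus> fst x, \<ominus> snd x)"]) (auto simp: l_neg)
  qed (auto simp: a_ac)
  show "comm_monoid (dual R)"
  proof (rule comm_monoidI)
    fix x y z assume "x \<in> carrier (dual R)" "y \<in> carrier (dual R)" "z \<in> carrier (dual R)"
    then show "x \<otimes>\<^bsub>dual R\<^esub> y \<otimes>\<^bsub>dual R\<^esub> z = x \<otimes>\<^bsub>dual R\<^esub> (y \<otimes>\<^bsub>dual R\<^esub> z)"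
      by (auto; algebra)
  next
    fix x y assume "x \<in> carrier (dual R)" "y \<in> carrier (dual R)"
    then show "x \<otimes>\<^bsub>dual R\<^esub> y = y \<otimes>\<^bsub>dual R\<^esub> x"
      by (auto simp: m_comm a_comm)
  qed auto
next
  fix x y z assume "x \<in> carrier (dual R)" "y \<in> carrier (dual R)" "z \<in> carrier (dual R)"
  then show "(x \<oplus>\<^bsub>dual R\<^esub> y) \<otimes>\<^bsub>dual R\<^esub> z = x \<otimes>\<^bsub>dual R\<^esub> z \<oplus>\<^bsub>dual R\<^esub> y \<otimes>\<^bsub>dual R\<^esub> z"
    by (auto; algebra)
qed

lemma dual_uminus:
  assumes "a \<in> carrier R" "a' \<in> carrier R"
  shows "\<ominus>\<^bsub>dual R\<^esub> (a, a') = (\<ominus> a, \<ominus> a')"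
proof -
  interpret D: cring "dual R" by (rule dual_cring)
  show ?thesis using assms by (intro D.minus_equality) (auto simp: l_neg)
qed

text \<open>First-order Taylor expansion, since e^2 = 0: perturbing the coefficients contributes
  linearly, and perturbing x by y contributes y times the derivative. It serves both for extending
  derivations and for the chain rule in Omega.\<close>

lemma peval_dual:
  assumes "set P \<subseteq> carrier R \<times> carrier R" "x \<in> carrier R" "y \<in> carrier R"
  shows "peval (dual R) P (x, y) =
    (peval R (map fst P) x,
     peval R (map snd P) x \<oplus> y \<otimes> peval R (pderiv R (map fst P)) x)"
  using assms(1)
proof (induction P rule: induct_list012)
  case 1
  then show ?case using assms by simp
next
  case (2 u)
  then show ?case using assms by (cases u) auto
next
  case (3 u v P)
  obtain c c' where u: "u = (c, c')" by force
  define Q where "Q = map fst (v # P)"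
  define Q' where "Q' = map snd (v # P)"
  have sets: "set Q \<subseteq> carrier R" "set Q' \<subseteq> carrier R" "c \<in> carrier R" "c' \<in> carrier R"
    using 3(3) by (auto simp: Q_def Q'_def u)
  have dQ: "set (pderiv R Q) \<subseteq> carrier R"
    using set_pderiv_subring[OF carrier_is_subring] sets by blast
  \<comment> \<open>This needs \<open>Q\<close> to be nonempty; for \<open>Q = []\<close> the
    right-hand side would be a list with one zero.\<close>
  have "pderiv R (c # Q) = padd R Q (\<zero> # pderiv R Q)"
    unfolding Q_def by simp
  then have eq: "peval R (pderiv R (c # Q)) x = peval R Q x \<oplus> x \<otimes> peval R (pderiv R Q) x"
    using sets dQ assms by (simp add: peval_padd)
  have IH: "peval (dual R) (v # P) (x, y) =
      (peval R Q x, peval R Q' x \<oplus> y \<otimes> peval R (pderiv R Q) x)"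
    using 3 unfolding Q_def Q'_def by simp
  have cl: "peval R Q x \<in> carrier R" "peval R Q' x \<in> carrier R" "peval R (pderiv R Q) x \<in> carrier R"
    using sets dQ assms by auto
  have "peval (dual R) (u # v # P) (x, y) =
     (peval R (c # Q) x, peval R (c' # Q') x \<oplus> y \<otimes> peval R (pderiv R (c # Q)) x)"
    unfolding peval.simps(2)[of "dual R" u] IH eq using cl sets assms
    by (simp add: u; algebra)
  then show ?case by (simp only: u Q_def Q'_def list.map fst_conv snd_conv)
qed

end

section \<open>Adjoining one element to a subring, and pseudo-division\<close>

text \<open>This is G[u]. A product of polynomials is never formed: closure under multiplication
  follows by Horner induction on the left factor from closure under sums, under factors from
  \<open>G\<close>, and under the factor \<open>u\<close>.\<close>

lemma (in cring) subring_peval: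
  assumes "subring G R" "u \<in> carrier R"
  shows "subring {peval R p u | p. set p \<subseteq> G} R"
proof -
  note G = subringE[OF assms(1)]
  define T where "T = {peval R p u | p. set p \<subseteq> G}"
  have TI: "peval R p u \<in> T" if "set p \<subseteq> G" for p
    using that by (auto simp: T_def)
  have TE: "\<exists>p. set p \<subseteq> G \<and> a = peval R p u" if "a \<in> T" for a
    using that by (auto simp: T_def)
  have carr: "set p \<subseteq> carrier R" if "set p \<subseteq> G" for p using that G(1) by blast
  have T_carr: "a \<in> carrier R" if "a \<in> T" for a using TE[OF that] carr assms(2) by auto
  have T_add: "a \<oplus> b \<in> T" if a: "a \<in> T" and b: "b \<in> T" for a b
  proof -
    obtain p q where p: "set p \<subseteq> G" "a = peval R p u" and q: "set q \<subseteq> G" "b = peval R q u"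
      using TE[OF a] TE[OF b] by blast
    have "peval R (padd R p q) u = a \<oplus> b"
      unfolding p(2) q(2) by (rule peval_padd[OF carr[OF p(1)] carr[OF q(1)] assms(2)])
    then show ?thesis using TI[OF set_padd_subring[OF assms(1) p(1) q(1)]] by simp
  qed
  have T_smult: "c \<otimes> a \<in> T" if c: "c \<in> G" and a: "a \<in> T" for a c
  proof -
    obtain p where p: "set p \<subseteq> G" "a = peval R p u" using TE[OF a] by blast
    have "peval R (map (\<lambda>b. c \<otimes> b) p) u = c \<otimes> a"
      unfolding p(2) by (rule peval_smult[OF carr[OF p(1)] _ assms(2)]) (use c G(1) in blast)
    moreover have "set (map (\<lambda>b. c \<otimes> b) p) \<subseteq> G" using p(1) c G(6) by auto
    ultimately show ?thesis using TI by metis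
  qed
  have T_u: "u \<otimes> a \<in> T" if a: "a \<in> T" for a
  proof -
    obtain p where p: "set p \<subseteq> G" "a = peval R p u" using TE[OF a] by blast
    have "peval R (\<zero> # p) u = u \<otimes> a" unfolding p(2) using carr[OF p(1)] assms(2) by simp
    moreover have "set (\<zero> # p) \<subseteq> G" using p(1) G(2) by simp
    ultimately show ?thesis using TI by metis
  qed
  have T_zero: "\<zero> \<in> T" using TI[of "[]"] by simp
  have T_mult: "peval R p u \<otimes> b \<in> T" if "set p \<subseteq> G" and b: "b \<in> T" for p b
    using that(1)
  proof (induction p)
    case Nil
    show ?case using T_zero T_carr[OF b] by simp
  next
    case (Cons c p)
    have p: "set p \<subseteq> G" "c \<in> G" using Cons(2) by auto
    have cl: "peval R p u \<in> carrier R" "b \<in> carrier R" "c \<in> carrier R"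
      using carr[OF p(1)] assms(2) T_carr[OF b] p(2) G(1) by auto
    have "peval R (c # p) u \<otimes> b = c \<otimes> b \<oplus> u \<otimes> (peval R p u \<otimes> b)"
      using cl assms(2) by (simp, algebra)
    then show ?case using T_add[OF T_smult[OF p(2) b] T_u[OF Cons(1)[OF p(1)]]] by simp
  qed
  have "subring T R"
  proof (rule subringI)
    show "T \<subseteq> carrier R" using T_carr by blast
    show "\<one> \<in> T" using TI[of "[\<one>]"] G(3) assms(2) by simp
  next
    fix a assume a: "a \<in> T"
    have "(\<ominus> \<one>) \<otimes> a = \<ominus> a" using T_carr[OF a] by (simp add: l_minus)
    then show "\<ominus> a \<in> T" using T_smult[OF G(5)[OF G(3)] a] by simp
  next
    fix a b assume a: "a \<in> T" and b: "b \<in> T"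
    obtain p where "set p \<subseteq> G" "a = peval R p u" using TE[OF a] by blast
    then show "a \<otimes> b \<in> T" using T_mult[OF _ b] by simp
  qed (rule T_add)
  then show ?thesis unfolding T_def .
qed

lemma (in cring) peval_zeros:
  assumes "set p \<subseteq> {\<zero>}" "x \<in> carrier R"
  shows "peval R p x = \<zero>"
  using assms by (induction p) auto

lemma (in cring) coeffs_zero_if_no_relation:
  assumes "L \<subseteq> carrier R" "x \<in> carrier R"
    and "\<And>f. f \<noteq> [] \<Longrightarrow> set f \<subseteq> L \<Longrightarrow> last f \<noteq> \<zero> \<Longrightarrow> length f \<le> n \<Longrightarrow> peval R f x \<noteq> \<zero>"
    and "set p \<subseteq> L" "peval R p x = \<zero>" "length p \<le> n"
  shows "set p \<subseteq> {\<zero>}"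
  using assms(4-)
proof (induction p rule: rev_induct)
  case (snoc c p)
  have p: "set p \<subseteq> L" "c \<in> L" "length p \<le> n" using snoc.prems(1,3) by auto
  have c: "c = \<zero>"
    using assms(3)[of "p @ [c]"] snoc.prems by fastforce
  have "peval R (p @ [c]) x = peval R p x \<oplus> x [^] length p \<otimes> peval R [c] x"
    using p assms(1,2) by (intro peval_append) auto
  then have "peval R p x = \<zero>"
    using snoc.prems(2) p(1) assms(1,2) peval_closed[of p x] by (simp add: c)
  then show ?case using snoc.IH p c by simp
qed auto

text \<open>A single step: c (Q @ [g]) - g X^j (F @ [c]) has no top term, and because
  \<open>F @ [c]\<close> vanishes at \<open>u\<close>, its value is c times that of
  \<open>Q @ [g]\<close>. Nothing is divided by c.\<close>

lemma (in cring) pseudo_division: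
  assumes G: "subring G R" and u: "u \<in> carrier R"
    and F: "set (F @ [c]) \<subseteq> G" "peval R (F @ [c]) u = \<zero>"
    and Q: "set (Q @ [g]) \<subseteq> G" and le: "length F \<le> length Q"
  shows "\<exists>Q'. set Q' \<subseteq> G \<and> length Q' = length Q \<and> peval R Q' u = c \<otimes> peval R (Q @ [g]) u"
proof (intro exI conjI)
  note Gs = subringE[OF G]
  define j where "j = length Q - length F"
  \<comment> \<open>Both lists leave out their top coefficients, c g and - g c, which
    cancel.\<close>
  define Q1 Q2 where "Q1 = map (\<lambda>a. c \<otimes> a) Q"
    and "Q2 = map (\<lambda>a. (\<ominus> g) \<otimes> a) (replicate j \<zero> @ F)"
  have G': "set P \<subseteq> carrier R" if "set P \<subseteq> G" for P using that Gs(1) by blast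
  have sets: "set Q1 \<subseteq> G" "set Q2 \<subseteq> G" "set (replicate j \<zero> @ F) \<subseteq> G" "set (replicate j \<zero>) \<subseteq> G"
      "set Q \<subseteq> G" "set F \<subseteq> G"
    using Q F Gs(2) by (auto simp: Q1_def Q2_def intro!: Gs(5,6))
  then show "set (padd R Q1 Q2) \<subseteq> G" by (intro set_padd_subring[OF G])
  show "length (padd R Q1 Q2) = length Q" using le by (simp add: Q1_def Q2_def j_def)
  define q f w v where "q = peval R Q u" and "f = peval R F u"
    and "w = u [^] length F" and "v = u [^] j"
  have cl: "q \<in> carrier R" "f \<in> carrier R" "w \<in> carrier R" "v \<in> carrier R" "c \<in> carrier R" "g \<in> carrier R"
    unfolding q_def f_def w_def v_def using sets[THEN G'] u F Q Gs(1) by auto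
  have f0: "f \<oplus> w \<otimes> c = \<zero>"
    using F(2) peval_append[of F "[c]" u] G'[OF sets(6)] cl u by (simp add: f_def w_def)
  have Pu: "peval R (Q @ [g]) u = q \<oplus> (v \<otimes> w) \<otimes> g"
    using peval_append[of Q "[g]" u] G'[OF sets(5)] cl u le
    by (simp add: q_def v_def w_def nat_pow_mult j_def)
  have "peval R (padd R Q1 Q2) u = peval R Q1 u \<oplus> peval R Q2 u"
    by (rule peval_padd[OF G'[OF sets(1)] G'[OF sets(2)] u])
  also have "peval R Q1 u = c \<otimes> q"
    unfolding Q1_def q_def using peval_smult[OF G'[OF sets(5)] cl(5) u] .
  also have "peval R Q2 u = (\<ominus> g) \<otimes> (v \<otimes> f)"
    unfolding Q2_def using peval_smult[OF G'[OF sets(3)] _ u, of "\<ominus> g"]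
      peval_append[OF G'[OF sets(4)] G'[OF sets(6)] u] peval_replicate_zero[OF u] cl
    by (simp add: f_def v_def)
  also have "c \<otimes> q \<oplus> (\<ominus> g) \<otimes> (v \<otimes> f)
      = c \<otimes> (q \<oplus> (v \<otimes> w) \<otimes> g) \<ominus> g \<otimes> v \<otimes> (f \<oplus> w \<otimes> c)"
    using cl by algebra
  also have "\<dots> = c \<otimes> peval R (Q @ [g]) u"
    unfolding f0 Pu using cl by algebra
  finally show "peval R (padd R Q1 Q2) u = c \<otimes> peval R (Q @ [g]) u" .
qed

section \<open>Extending derivations in a domain\<close>

text \<open>
  A derivation \<open>\<delta> : L \<rightarrow> R\<close> on a subring \<open>L\<close> of \<open>R\<close> is the same thing as a subring of the dual
  numbers, its graph, that contains no nonzero \<open>(\<zero>, z)\<close>.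
\<close>

definition derivation_graph :: "('a, 'm) ring_scheme \<Rightarrow> ('a \<times> 'a) set \<Rightarrow> bool" where
  "derivation_graph R G \<longleftrightarrow> subring G (dual R) \<and> (\<forall>z. (\<zero>\<^bsub>R\<^esub>, z) \<in> G \<longrightarrow> z = \<zero>\<^bsub>R\<^esub>)"

context domain
begin

interpretation D: cring "dual R"
  by (rule dual_cring)

text \<open>The extension is G[(x, y)]. Its elements above zero are values of polynomials over
  \<open>G\<close> whose first component vanishes, so \<open>key\<close> says precisely that the
  value y may consistently be assigned to x.\<close>

lemma derivation_graph_adjoin:
  assumes G: "derivation_graph R G" and x: "x \<in> carrier R" and y: "y \<in> carrier R"
    and key: "\<And>P. set P \<subseteq> G \<Longrightarrow> fst (peval (dual R) P (x, y)) = \<zero> \<Longrightarrow> peval (dual R) P (x, y) = \<zero>\<^bsub>dual R\<^esub>"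
  shows "\<exists>H. derivation_graph R H \<and> G \<subseteq> H \<and> (x, y) \<in> H"
proof (intro exI conjI)
  let ?H = "{peval (dual R) P (x, y) | P. set P \<subseteq> G}"
  have sub: "subring G (dual R)" using G by (simp add: derivation_graph_def)
  note Gs = subringE[OF sub]
  have "z = \<zero>" if "(\<zero>, z) \<in> ?H" for z
  proof -
    from that obtain P where P: "set P \<subseteq> G" "peval (dual R) P (x, y) = (\<zero>, z)" by auto
    show ?thesis using key[OF P(1)] P(2) by simp
  qed
  then show "derivation_graph R ?H"
    unfolding derivation_graph_def using D.subring_peval[OF sub, of "(x, y)"] x y by auto
  show "G \<subseteq> ?H"
  proof
    fix g assume g: "g \<in> G"
    then have "g = peval (dual R) [g] (x, y)" using x y Gs(1) by (cases g) auto
    then show "g \<in> ?H" using g by (intro CollectI exI[of _ "[g]"]) auto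
  qed
  have "(x, y) = peval (dual R) [\<zero>\<^bsub>dual R\<^esub>, \<one>\<^bsub>dual R\<^esub>] (x, y)" using x y by simp
  then show "(x, y) \<in> ?H" using Gs(2,3) by (intro CollectI exI[of _ "[\<zero>\<^bsub>dual R\<^esub>, \<one>\<^bsub>dual R\<^esub>]"]) auto
qed

lemma derivation_graph_zero_list:
  assumes G: "derivation_graph R G" and "set P \<subseteq> G" and "set (map fst P) \<subseteq> {\<zero>}"
    and u: "u \<in> carrier R \<times> carrier R"
  shows "peval (dual R) P u = \<zero>\<^bsub>dual R\<^esub>"
proof (rule D.peval_zeros)
  show "set P \<subseteq> {\<zero>\<^bsub>dual R\<^esub>}"
  proof
    fix g assume g: "g \<in> set P"
    obtain a b where ab: "g = (a, b)" by force
    have "a = \<zero>" using g ab assms(3) by force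
    then show "g \<in> {\<zero>\<^bsub>dual R\<^esub>}" using g ab assms(1,2) by (auto simp: derivation_graph_def)
  qed
qed (use u in auto)

text \<open>Without relations there is no condition to meet: a polynomial whose first component
  vanishes at x has only zero coefficients, so y is arbitrary.\<close>

lemma derivation_graph_adjoin_transcendental:
  assumes G: "derivation_graph R G" and x: "x \<in> carrier R" and y: "y \<in> carrier R"
    and trans: "\<And>f. f \<noteq> [] \<Longrightarrow> set f \<subseteq> fst ` G \<Longrightarrow> last f \<noteq> \<zero> \<Longrightarrow> peval R f x \<noteq> \<zero>"
  shows "\<exists>H. derivation_graph R H \<and> G \<subseteq> H \<and> (x, y) \<in> H"
proof (rule derivation_graph_adjoin[OF G x y])
  fix P assume P: "set P \<subseteq> G" "fst (peval (dual R) P (x, y)) = \<zero>"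
  have Gc: "G \<subseteq> carrier R \<times> carrier R"
    using subringE(1)[of G "dual R"] G by (simp add: derivation_graph_def)
  have "peval R (map fst P) x = \<zero>" using P peval_dual[of P x y] Gc x y by auto
  then have "set (map fst P) \<subseteq> {\<zero>}"
    using Gc P(1) coeffs_zero_if_no_relation[of "fst ` G" x "length P" "map fst P"] trans x by force
  then show "peval (dual R) P (x, y) = \<zero>\<^bsub>dual R\<^esub>"
    using derivation_graph_zero_list[OF G P(1)] x y by simp
qed

text \<open>
  Pseudo-division by the minimal relation \<open>F @ [c]\<close>; the leading coefficient is only cancellable,
  not invertible.
\<close>

lemma derivation_graph_adjoin_algebraic:
  assumes G: "derivation_graph R G" and x: "x \<in> carrier R" and y: "y \<in> carrier R"
    and F: "set (F @ [c]) \<subseteq> G" "fst c \<noteq> \<zero>" "peval (dual R) (F @ [c]) (x, y) = \<zero>\<^bsub>dual R\<^esub>"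
    and min: "\<And>f. f \<noteq> [] \<Longrightarrow> set f \<subseteq> fst ` G \<Longrightarrow> last f \<noteq> \<zero> \<Longrightarrow> length f \<le> length F \<Longrightarrow> peval R f x \<noteq> \<zero>"
  shows "\<exists>H. derivation_graph R H \<and> G \<subseteq> H \<and> (x, y) \<in> H"
proof (rule derivation_graph_adjoin[OF G x y])
  let ?u = "(x, y)"
  have u: "?u \<in> carrier (dual R)" using x y by simp
  have sub: "subring G (dual R)" using G by (simp add: derivation_graph_def)
  note Gs = subringE[OF sub]
  have Gc: "G \<subseteq> carrier R \<times> carrier R" using Gs(1) by simp
  have Gc': "set P \<subseteq> carrier (dual R)" if "set P \<subseteq> G" for P using that Gs(1) by blast
  fix P assume "set P \<subseteq> G" "fst (peval (dual R) P ?u) = \<zero>"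
  then show "peval (dual R) P ?u = \<zero>\<^bsub>dual R\<^esub>"
  \<comment> \<open>Lists no longer than \<open>F\<close> have zero coefficients by minimality; a
    longer one is replaced by its pseudo-remainder.\<close>
  proof (induction "length P" arbitrary: P rule: less_induct)
    case less
    show ?case
    proof (cases "length P \<le> length F")
      case True
      have "peval R (map fst P) x = \<zero>" using less peval_dual[of P x y] Gc x y by auto
      then have "set (map fst P) \<subseteq> {\<zero>}"
        using Gc less(2) True coeffs_zero_if_no_relation[of "fst ` G" x "length F" "map fst P"] min x by force
      then show ?thesis
        using derivation_graph_zero_list[OF G less(2)] x y by simp
    next
      case False
      then obtain Q g where P: "P = Q @ [g]" by (metis append_butlast_last_id list.size(3) zero_le)
      then have le: "length F \<le> length Q" using False by simp
      obtain Q' where Q': "set Q' \<subseteq> G" "length Q' < length P"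
          "peval (dual R) Q' ?u = c \<otimes>\<^bsub>dual R\<^esub> peval (dual R) P ?u"
        using D.pseudo_division[OF sub u F(1,3) _ le, of g] less(2) P by auto
      obtain z where z: "peval (dual R) P ?u = (\<zero>, z)" "z \<in> carrier R"
        using less(3) D.peval_closed[OF Gc'[OF less(2)] u] by (cases "peval (dual R) P ?u") auto
      obtain c1 c2 where c: "c = (c1, c2)" "c1 \<in> carrier R" "c2 \<in> carrier R" using F(1) Gc by (cases c) auto
      have "peval (dual R) Q' ?u = \<zero>\<^bsub>dual R\<^esub>"
        by (rule less(1)[OF Q'(2,1)]) (simp add: Q'(3) z c)
      \<comment> \<open>Multiplication by \<open>c\<close> sends (0, z) to (0, c1 z), and c1 is a
        nonzero element of a domain.\<close>
      then have "c1 \<otimes> z = \<zero>" using Q'(3) z c by simp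
      then have "z = \<zero>" using integral[of c1 z] c z F(2) by auto
      then show ?thesis using z by simp
    qed
  qed
qed

text \<open>The substitution of s e for e; it carries the graph of a derivation to the graph of s
  times that derivation.\<close>

lemma dual_scale_ring_hom:
  assumes "s \<in> carrier R"
  shows "ring_hom_ring (dual R) (dual R) (\<lambda>(a, a'). (a, s \<otimes> a'))"
  using assms
  by (intro ring_hom_ringI D.ring_axioms) (auto; algebra)+

text \<open>A transcendental x gets the value zero, with s = 1. For an algebraic x the factor s is
  f'(x), where f is a relation of least length over the domain of definition of the
  derivation.\<close>

lemma derivation_graph_extend:
  assumes char0: "\<And>n::nat. n > 0 \<Longrightarrow> [n] \<cdot> \<one> \<noteq> \<zero>"
    and G: "derivation_graph R G" and x: "x \<in> carrier R"
  shows "\<exists>H s. derivation_graph R H \<and> s \<in> carrier R \<and> s \<noteq> \<zero> \<and>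
    (\<forall>a b. (a, b) \<in> G \<longrightarrow> (a, s \<otimes> b) \<in> H) \<and> x \<in> fst ` H"
proof -
  have sub: "subring G (dual R)" using G by (simp add: derivation_graph_def)
  note Gs = subringE[OF sub]
  have Gc: "G \<subseteq> carrier R \<times> carrier R" using Gs(1) by simp
  let ?rel = "\<lambda>f. f \<noteq> [] \<and> set f \<subseteq> fst ` G \<and> last f \<noteq> \<zero> \<and> peval R f x = \<zero>"
  show ?thesis
  proof (cases "\<exists>f. ?rel f")
    case False
    then obtain H where H: "derivation_graph R H" "G \<subseteq> H" "(x, \<zero>) \<in> H"
      using derivation_graph_adjoin_transcendental[OF G x zero_closed] by blast
    have "(a, \<one> \<otimes> b) \<in> H" if "(a, b) \<in> G" for a b
      using subsetD[OF H(2) that] subsetD[OF Gc that] by simp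
    moreover have "x \<in> fst ` H" using H(3) by force
    ultimately show ?thesis using H(1) by (intro exI[of _ H] exI[of _ \<one>]) auto
  next
    case True
    then obtain f where f: "?rel f" and min: "\<And>g. ?rel g \<Longrightarrow> length f \<le> length g"
      using ex_has_least_nat[of ?rel _ length] by blast
    have Lsub: "subring (fst ` G) R"
    proof -
      have "fst \<in> ring_hom (dual R) R" by (auto simp: ring_hom_def)
      then interpret h: ring_hom_ring "dual R" R fst
        by (intro ring_hom_ringI2 D.ring_axioms ring_axioms)
      show ?thesis by (rule h.img_is_subring[OF sub])
    qed
    note Ls = subringE[OF Lsub]
    obtain c f0 where fc: "f = f0 @ [c]" using f by (metis append_butlast_last_id)
    have fL: "set f \<subseteq> carrier R" using f Ls(1) by blast
    \<comment> \<open>A relation of length one would be a nonzero constant equal to zero, so the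
      derivative of f is a nonempty list.\<close>
    have "f0 \<noteq> []" using f fc fL x by auto
    then have len: "length f \<ge> 2" unfolding fc by (cases f0) auto
    define s where "s = peval R (pderiv R f) x"
    have dL: "set (pderiv R f) \<subseteq> fst ` G" using set_pderiv_subring[OF Lsub] f by blast
    have s: "s \<in> carrier R" unfolding s_def using dL Ls(1) x by auto
    \<comment> \<open>Otherwise the derivative would be a shorter relation: its leading coefficient
      is the degree times that of f, nonzero in characteristic zero.\<close>
    have "s \<noteq> \<zero>"
    proof
      assume "s = \<zero>"
      have c: "c \<in> carrier R" "c \<noteq> \<zero>" using fL f by (auto simp: fc)
      have "last (pderiv R f) = ([length f0] \<cdot> \<one>) \<otimes> c"
        using last_pderiv_mult[OF fL len] by (simp add: fc)
      also have "\<dots> \<noteq> \<zero>"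
        using char0[of "length f0"] \<open>f0 \<noteq> []\<close> c integral_iff[of "[length f0] \<cdot> \<one>" c] by simp
      finally have "?rel (pderiv R f)"
        using dL \<open>s = \<zero>\<close> len by (auto simp: s_def simp flip: length_greater_0_conv)
      from min[OF this] len show False by simp
    qed
    let ?\<sigma> = "\<lambda>(a, a'). (a, s \<otimes> a')"
    interpret \<sigma>: ring_hom_ring "dual R" "dual R" ?\<sigma>
      by (rule dual_scale_ring_hom[OF s])
    obtain P where P: "set P \<subseteq> G" "map fst P = f"
    proof -
      have "f \<in> lists (fst ` G)" using f by auto
      then have "f \<in> map fst ` lists G" by (simp add: lists_image)
      then show ?thesis using that by auto
    qed
    have Pc: "set P \<subseteq> carrier R \<times> carrier R" using P(1) Gc by blast
    \<comment> \<open>For the scaled derivation the condition on y reads s f^delta(x) + y s = 0,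
      where f^delta is \<open>map snd P\<close>, and this y solves it.\<close>
    define y where "y = \<ominus> peval R (map snd P) x"
    have sP: "set (map snd P) \<subseteq> carrier R" using Pc by auto
    then have y: "y \<in> carrier R" unfolding y_def using x by auto
    define P' where "P' = map ?\<sigma> P"
    have P': "set P' \<subseteq> carrier R \<times> carrier R" "map fst P' = f" "map snd P' = map (\<lambda>b. s \<otimes> b) (map snd P)"
      using Pc s P(2) by (auto simp: P'_def)
    have "peval (dual R) P' (x, y) = (peval R f x, s \<otimes> peval R (map snd P) x \<oplus> y \<otimes> s)"
      unfolding peval_dual[OF P'(1) x y] P'(2,3) peval_smult[OF sP s x] by (simp only: s_def)
    also have "\<dots> = \<zero>\<^bsub>dual R\<^esub>"
      using f s sP x peval_closed[OF sP x] unfolding y_def by (simp, algebra)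
    finally have P'0: "peval (dual R) P' (x, y) = \<zero>\<^bsub>dual R\<^esub>" .
    define G' where "G' = ?\<sigma> ` G"
    have G': "derivation_graph R G'"
      unfolding derivation_graph_def
    proof (intro conjI allI impI)
      show "subring G' (dual R)" unfolding G'_def by (rule \<sigma>.img_is_subring[OF sub])
      fix z assume "(\<zero>, z) \<in> G'"
      then show "z = \<zero>" using G s unfolding G'_def derivation_graph_def by auto
    qed
    have fstG': "fst ` G' = fst ` G" unfolding G'_def by force
    obtain P0 p where Pp: "P' = P0 @ [p]" "map fst P0 = f0" "fst p = c"
      using P'(2) unfolding fc by (cases P' rule: rev_cases) auto
    have P'G: "set (P0 @ [p]) \<subseteq> G'" unfolding Pp(1)[symmetric] P'_def G'_def using P(1) by auto
    have "length P0 < length f" using Pp(2) fc by auto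
    then have min': "peval R g x \<noteq> \<zero>"
      if "g \<noteq> []" "set g \<subseteq> fst ` G'" "last g \<noteq> \<zero>" "length g \<le> length P0" for g
      using min[of g] that unfolding fstG' by linarith
    have "fst p \<noteq> \<zero>" using f unfolding fc Pp(3) by simp
    from derivation_graph_adjoin_algebraic[OF G' x y P'G this P'0[unfolded Pp(1)] min']
    obtain H where H: "derivation_graph R H" "G' \<subseteq> H" "(x, y) \<in> H" by blast
    have "(a, s \<otimes> b) \<in> H" if "(a, b) \<in> G" for a b
      using that H(2) unfolding G'_def by auto
    moreover have "x \<in> fst ` H" using H(3) by force
    ultimately show ?thesis using H(1) s \<open>s \<noteq> \<zero>\<close> by blast
  qed
qed

text \<open>The start is d/dt on K[t], and the elements of \<open>F\<close> are adjoined in turn.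
  Each step multiplies by some nonzero s, so the value one at \<open>t\<close> survives only as a
  nonzero \<open>y\<close>, while the value zero on \<open>K\<close> is kept.\<close>

lemma derivation_graph_extend_finite:
  assumes char0: "\<And>n::nat. n > 0 \<Longrightarrow> [n] \<cdot> \<one> \<noteq> \<zero>"
    and K: "subring K R" and t: "t \<in> carrier R"
    and trans: "\<And>f. f \<noteq> [] \<Longrightarrow> set f \<subseteq> K \<Longrightarrow> last f \<noteq> \<zero> \<Longrightarrow> peval R f t \<noteq> \<zero>"
    and F: "finite F" "F \<subseteq> carrier R"
  shows "\<exists>H y. derivation_graph R H \<and> K \<times> {\<zero>} \<subseteq> H \<and> (t, y) \<in> H \<and> y \<noteq> \<zero> \<and> F \<subseteq> fst ` H"
  using F
proof (induction F)
  case empty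
  note Ks = subringE[OF K]
  have "subring (K \<times> {\<zero>}) (dual R)"
    using Ks by (intro D.subringI) (auto simp: dual_uminus subset_iff)
  then have "derivation_graph R (K \<times> {\<zero>})" by (simp add: derivation_graph_def)
  moreover have "fst ` (K \<times> {\<zero>}) = K" by force
  ultimately obtain H where "derivation_graph R H" "K \<times> {\<zero>} \<subseteq> H" "(t, \<one>) \<in> H"
    using derivation_graph_adjoin_transcendental[of "K \<times> {\<zero>}" t \<one>] t trans by auto
  then show ?case using one_not_zero by blast
next
  case (insert x F)
  then obtain G y where G: "derivation_graph R G" "K \<times> {\<zero>} \<subseteq> G" "(t, y) \<in> G" "y \<noteq> \<zero>" "F \<subseteq> fst ` G"
    by auto
  obtain H s where H: "derivation_graph R H" "s \<in> carrier R" "s \<noteq> \<zero>"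
      "\<And>a b. (a, b) \<in> G \<Longrightarrow> (a, s \<otimes> b) \<in> H" "x \<in> fst ` H"
    using derivation_graph_extend[OF char0 G(1), of x] insert by auto
  have "y \<in> carrier R"
    using subringE(1)[of G "dual R"] G(1,3) unfolding derivation_graph_def by auto
  then have "s \<otimes> y \<noteq> \<zero>" using integral_iff[of s y] H(2,3) G(4) by simp
  moreover have "(t, s \<otimes> y) \<in> H" using H(4) G(3) by blast
  moreover have "K \<times> {\<zero>} \<subseteq> H"
  proof
    fix g assume "g \<in> K \<times> {\<zero>}"
    then obtain a where "g = (a, \<zero>)" "(a, \<zero>) \<in> G" using G(2) by auto
    then show "g \<in> H" using H(4)[of a \<zero>] H(2) by simp
  qed
  moreover have "insert x F \<subseteq> fst ` H"
  proof -
    have "a \<in> fst ` H" if a: "a \<in> F" for a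
    proof -
      obtain b where "(a, b) \<in> G" using G(5) a by force
      then show ?thesis using H(4) by force
    qed
    then show ?thesis using H(5) by blast
  qed
  ultimately show ?case using H(1) by blast
qed

end

section \<open>Free modules and Kaehler differentials\<close>

lemma free_module_simps [simp]:
  "f \<in> carrier (free_module A U) \<longleftrightarrow>
     (\<forall>x\<in>U. f x \<in> carrier A) \<and> (\<forall>x. x \<notin> U \<longrightarrow> f x = \<zero>\<^bsub>A\<^esub>) \<and> finite {x. f x \<noteq> \<zero>\<^bsub>A\<^esub>}"
  "\<zero>\<^bsub>free_module A U\<^esub> = (\<lambda>x. \<zero>\<^bsub>A\<^esub>)"
  "f \<oplus>\<^bsub>free_module A U\<^esub> g = (\<lambda>x. f x \<oplus>\<^bsub>A\<^esub> g x)"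
  "a \<odot>\<^bsub>free_module A U\<^esub> f = (\<lambda>x. a \<otimes>\<^bsub>A\<^esub> f x)"
  by (auto simp: free_module_def)

context cring
begin

lemma free_module_apply_closed:
  assumes "f \<in> carrier (free_module R U)"
  shows "f x \<in> carrier R"
  using assms by (cases "x \<in> U") auto

lemma free_module_is_module: "module R (free_module R U)"
proof (rule moduleI)
  let ?F = "free_module R U"
  show "abelian_group ?F"
  proof (rule abelian_groupI)
    fix f g assume fg: "f \<in> carrier ?F" "g \<in> carrier ?F"
    have "{x. f x \<oplus> g x \<noteq> \<zero>} \<subseteq> {x. f x \<noteq> \<zero>} \<union> {x. g x \<noteq> \<zero>}" by auto
    then have "finite {x. f x \<oplus> g x \<noteq> \<zero>}"
      by (rule finite_subset) (use fg in auto)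
    then show "f \<oplus>\<^bsub>?F\<^esub> g \<in> carrier ?F" using fg by auto
    show "f \<oplus>\<^bsub>?F\<^esub> g = g \<oplus>\<^bsub>?F\<^esub> f"
      using fg[THEN free_module_apply_closed] by (auto simp: a_comm)
  next
    fix f g h assume "f \<in> carrier ?F" "g \<in> carrier ?F" "h \<in> carrier ?F"
    note fgh = this[THEN free_module_apply_closed]
    show "f \<oplus>\<^bsub>?F\<^esub> g \<oplus>\<^bsub>?F\<^esub> h = f \<oplus>\<^bsub>?F\<^esub> (g \<oplus>\<^bsub>?F\<^esub> h)"
      using fgh by (auto simp: a_assoc)
  next
    fix f assume f: "f \<in> carrier ?F"
    note f' = free_module_apply_closed[OF f]
    show "\<zero>\<^bsub>?F\<^esub> \<oplus>\<^bsub>?F\<^esub> f = f" using f' by auto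
    have "{x. \<ominus> f x \<noteq> \<zero>} \<subseteq> {x. f x \<noteq> \<zero>}" by auto
    then have "finite {x. \<ominus> f x \<noteq> \<zero>}"
      by (rule finite_subset) (use f in auto)
    then show "\<exists>g\<in>carrier ?F. g \<oplus>\<^bsub>?F\<^esub> f = \<zero>\<^bsub>?F\<^esub>"
      using f f' by (intro bexI[of _ "\<lambda>x. \<ominus> f x"]) (auto simp: l_neg)
  qed auto
next
  let ?F = "free_module R U"
  fix a f assume a: "a \<in> carrier R" and f: "f \<in> carrier ?F"
  have "{x. a \<otimes> f x \<noteq> \<zero>} \<subseteq> {x. f x \<noteq> \<zero>}" using a by auto
  then have "finite {x. a \<otimes> f x \<noteq> \<zero>}"
    by (rule finite_subset) (use f in auto)
  then show "a \<odot>\<^bsub>?F\<^esub> f \<in> carrier ?F" using f a by auto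
next
  let ?F = "free_module R U"
  fix f assume "f \<in> carrier ?F"
  note f = free_module_apply_closed[OF this]
  show "\<one> \<odot>\<^bsub>?F\<^esub> f = f" using f by auto
  fix a b assume a: "a \<in> carrier R" and b: "b \<in> carrier R"
  show "(a \<oplus> b) \<odot>\<^bsub>?F\<^esub> f = a \<odot>\<^bsub>?F\<^esub> f \<oplus>\<^bsub>?F\<^esub> b \<odot>\<^bsub>?F\<^esub> f"
    using a b f by (simp add: l_distr)
  show "(a \<otimes> b) \<odot>\<^bsub>?F\<^esub> f = a \<odot>\<^bsub>?F\<^esub> (b \<odot>\<^bsub>?F\<^esub> f)"
    using a b f by (simp add: m_assoc)
next
  let ?F = "free_module R U"
  fix a f g assume a: "a \<in> carrier R" and "f \<in> carrier ?F" "g \<in> carrier ?F"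
  note fg = this(2,3)[THEN free_module_apply_closed]
  show "a \<odot>\<^bsub>?F\<^esub> (f \<oplus>\<^bsub>?F\<^esub> g) = a \<odot>\<^bsub>?F\<^esub> f \<oplus>\<^bsub>?F\<^esub> a \<odot>\<^bsub>?F\<^esub> g"
    using a fg by (simp add: r_distr)
qed (rule is_cring)

lemma free_module_minus:
  assumes "f \<in> carrier (free_module R U)" "g \<in> carrier (free_module R U)"
  shows "f \<ominus>\<^bsub>free_module R U\<^esub> g = (\<lambda>x. f x \<ominus> g x)"
proof -
  let ?F = "free_module R U"
  interpret F: module R ?F by (rule free_module_is_module)
  have g': "\<ominus>\<^bsub>?F\<^esub> g \<in> carrier ?F" using assms by (intro F.a_inv_closed)
  have "\<ominus>\<^bsub>?F\<^esub> g \<oplus>\<^bsub>?F\<^esub> g = \<zero>\<^bsub>?F\<^esub>" using assms by (intro F.M.l_neg)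
  then have "(\<ominus>\<^bsub>?F\<^esub> g) x \<oplus> g x = \<zero>" for x by (auto dest: fun_cong)
  then have "(\<ominus>\<^bsub>?F\<^esub> g) x = \<ominus> g x" for x
    using free_module_apply_closed[OF assms(2)] free_module_apply_closed[OF g'] minus_equality[of _ "g x"]
    by metis
  then show ?thesis by (auto simp: a_minus_def)
qed

lemma basis_elt_closed:
  assumes "x \<in> U"
  shows "basis_elt R x \<in> carrier (free_module R U)"
proof -
  have "{y. basis_elt R x y \<noteq> \<zero>} \<subseteq> {x}" by (auto simp: basis_elt_def)
  then have "finite {y. basis_elt R x y \<noteq> \<zero>}" by (rule finite_subset) simp
  then show ?thesis using assms by (auto simp: basis_elt_def)
qed

text \<open>Induction on the size of the support: clear one coordinate, then add it back as a
  multiple of a basis element.\<close>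

lemma free_module_subset_if_basis:
  assumes N: "submodule N R (free_module R U)" and d: "\<And>x. x \<in> U \<Longrightarrow> basis_elt R x \<in> N"
  shows "carrier (free_module R U) \<subseteq> N"
proof
  let ?F = "free_module R U"
  interpret F: module R ?F by (rule free_module_is_module)
  fix f assume "f \<in> carrier ?F"
  then show "f \<in> N"
  proof (induction "card {x. f x \<noteq> \<zero>}" arbitrary: f rule: less_induct)
    case less
    have f: "f x \<in> carrier R" for x by (rule free_module_apply_closed[OF less(2)])
    show ?case
    proof (cases "f = (\<lambda>x. \<zero>)")
      case True
      then show ?thesis using subgroup.one_closed[OF submodule.axioms(1)[OF N]] by simp
    next
      case False
      then obtain x where x: "f x \<noteq> \<zero>" by auto
      then have xU: "x \<in> U" using less(2) by auto
      let ?g = "f(x := \<zero>)"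
      have supp: "{y. ?g y \<noteq> \<zero>} = {y. f y \<noteq> \<zero>} - {x}" by auto
      have fin: "finite {y. f y \<noteq> \<zero>}" using less(2) by simp
      have "finite {y. ?g y \<noteq> \<zero>}" unfolding supp using fin by simp
      then have "?g \<in> carrier ?F" using less(2) xU by simp
      moreover have "card {y. ?g y \<noteq> \<zero>} < card {y. f y \<noteq> \<zero>}"
        unfolding supp using fin x by (intro card_Diff1_less) auto
      ultimately have "?g \<in> N" using less(1) by blast
      moreover have "f x \<odot>\<^bsub>?F\<^esub> basis_elt R x \<in> N"
        using F.submoduleE(4)[OF N f d[OF xU]] .
      ultimately have "?g \<oplus>\<^bsub>?F\<^esub> f x \<odot>\<^bsub>?F\<^esub> basis_elt R x \<in> N"
        using F.submoduleE(5)[OF N] by blast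
      also have "?g \<oplus>\<^bsub>?F\<^esub> f x \<odot>\<^bsub>?F\<^esub> basis_elt R x = f"
        using f by (auto simp: basis_elt_def)
      finally show ?thesis .
    qed
  qed
qed

end

section \<open>Spans, zero quotients and the submodule of Kaehler relations\<close>

context module
begin

lemma submodule_span:
  assumes "S \<subseteq> carrier M"
  shows "submodule (span_submodule R M S) R M"
proof -
  have carr: "submodule (carrier M) R M" by (intro submoduleI) auto
  have eq: "span_submodule R M S = \<Inter>{N. submodule N R M \<and> S \<subseteq> N}"
    by (auto simp: span_submodule_def hull_def)
  show ?thesis unfolding eq
  proof (rule submoduleI)
    show "\<Inter>{N. submodule N R M \<and> S \<subseteq> N} \<subseteq> carrier M" using carr assms by blast
    show "\<zero>\<^bsub>M\<^esub> \<in> \<Inter>{N. submodule N R M \<and> S \<subseteq> N}"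
      using subgroup.one_closed[OF submodule.axioms(1)] by fastforce
  next
    fix a b assume "a \<in> \<Inter>{N. submodule N R M \<and> S \<subseteq> N}" "b \<in> \<Inter>{N. submodule N R M \<and> S \<subseteq> N}"
    then show "a \<oplus>\<^bsub>M\<^esub> b \<in> \<Inter>{N. submodule N R M \<and> S \<subseteq> N}"
      using submoduleE(5) by blast
  next
    fix a assume "a \<in> \<Inter>{N. submodule N R M \<and> S \<subseteq> N}"
    then show "\<ominus>\<^bsub>M\<^esub> a \<in> \<Inter>{N. submodule N R M \<and> S \<subseteq> N}"
      using submoduleE(3) by blast
  next
    fix a b assume "a \<in> carrier R" "b \<in> \<Inter>{N. submodule N R M \<and> S \<subseteq> N}"
    then show "a \<odot>\<^bsub>M\<^esub> b \<in> \<Inter>{N. submodule N R M \<and> S \<subseteq> N}"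
      using submoduleE(4) by blast
  qed
qed

text \<open>Each f lies in its own coset, so if \<open>N\<close> is the only coset it contains every
  f.\<close>

lemma zero_module_quotient_iff:
  assumes N: "submodule N R M"
  shows "zero_module (quotient_module M N) \<longleftrightarrow> N = carrier M"
proof -
  note sub = submodule.axioms(1)[OF N]
  have N0: "N \<subseteq> carrier M" "\<zero>\<^bsub>M\<^esub> \<in> N"
    using submoduleE(1)[OF N] subgroup.one_closed[OF sub] by auto
  have self: "f \<in> N +>\<^bsub>M\<^esub> f" if "f \<in> carrier M" for f
    using that N0 by (auto simp: a_r_coset_def' intro!: bexI[of _ "\<zero>\<^bsub>M\<^esub>"])
  have eq: "N +>\<^bsub>M\<^esub> f = N" if "f \<in> N" for f
    unfolding a_r_coset_def using M.add.coset_join2[OF _ sub] that N0 by auto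
  show ?thesis
  proof
    assume "zero_module (quotient_module M N)"
    then have "(\<Union>f\<in>carrier M. {N +>\<^bsub>M\<^esub> f}) = {N}"
      by (simp add: zero_module_def quotient_module_def A_RCOSETS_def' )
    then have "N +>\<^bsub>M\<^esub> f = N" if "f \<in> carrier M" for f using that by blast
    then show "N = carrier M" using self N0 by blast
  next
    assume "N = carrier M"
    then have "(\<Union>f\<in>carrier M. {N +>\<^bsub>M\<^esub> f}) = {N}" using eq N0 by blast
    then show "zero_module (quotient_module M N)"
      by (simp add: zero_module_def quotient_module_def A_RCOSETS_def' )
  qed
qed

end

text \<open>The kernel of the presentation of Omega by symbols. Later computations take place in the
  free module modulo this submodule rather than in the quotient.\<close>

definition kaehler_submodule :: "('k, 'm) ring_scheme \<Rightarrow> ('k, 'a, 'n) module_scheme \<Rightarrow> ('a \<Rightarrow> 'a) set" where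
  "kaehler_submodule k A = span_submodule A (free_module A (carrier A)) (kaehler_relations k A)"

context algebra
begin

lemma kaehler_relations_closed:
  "kaehler_relations R M \<subseteq> carrier (free_module M (carrier M))"
proof -
  interpret F: module M "free_module M (carrier M)" by (rule cring.free_module_is_module[OF M_cring])
  show ?thesis
    unfolding kaehler_relations_def Let_def
    by (auto simp del: free_module_simps intro!: F.M.minus_closed F.M.add.m_closed F.smult_closed cring.basis_elt_closed[OF M_cring])
qed

lemma kaehler_submodule_submodule: "submodule (kaehler_submodule R M) M (free_module M (carrier M))"
proof -
  interpret F: module M "free_module M (carrier M)" by (rule cring.free_module_is_module[OF M_cring])
  show ?thesis
    unfolding kaehler_submodule_def by (rule F.submodule_span[OF kaehler_relations_closed])
qed

lemma kaehler_relations_subset: "kaehler_relations R M \<subseteq> kaehler_submodule R M"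
  unfolding kaehler_submodule_def span_submodule_def by (rule hull_subset)

lemma zero_kaehler_iff:
  "zero_module (kaehler_differentials R M) \<longleftrightarrow> kaehler_submodule R M = carrier (free_module M (carrier M))"
proof -
  interpret F: module M "free_module M (carrier M)" by (rule cring.free_module_is_module[OF M_cring])
  show ?thesis
    unfolding kaehler_differentials_def Let_def kaehler_submodule_def[symmetric]
    by (rule F.zero_module_quotient_iff[OF kaehler_submodule_submodule])
qed

lemma zero_kaehlerI:
  assumes "\<And>x. x \<in> carrier M \<Longrightarrow> basis_elt M x \<in> kaehler_submodule R M"
  shows "zero_module (kaehler_differentials R M)"
proof -
  interpret F: module M "free_module M (carrier M)" by (rule cring.free_module_is_module[OF M_cring])
  show ?thesis
    using cring.free_module_subset_if_basis[OF M_cring kaehler_submodule_submodule assms]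
      F.submoduleE(1)[OF kaehler_submodule_submodule]
    unfolding zero_kaehler_iff by blast
qed

end

section \<open>Derivations on finite sets and their induced linear maps\<close>

text \<open>The laws are conditional on the result lying in \<open>F\<close>, because
  \<open>F\<close> will be a finite set without any closure property. The values lie in
  \<open>S\<close>, on which \<open>A\<close> acts through \<open>h\<close>.\<close>

definition partial_derivation ::
  "('k, 'm) ring_scheme \<Rightarrow> ('k, 'a, 'n) module_scheme \<Rightarrow> ('b, 'p) ring_scheme \<Rightarrow> ('a \<Rightarrow> 'b) \<Rightarrow>
    'a set \<Rightarrow> ('a \<Rightarrow> 'b) \<Rightarrow> bool" where
  "partial_derivation k A S h F \<delta> \<longleftrightarrow>
    (\<forall>x\<in>F. \<delta> x \<in> carrier S) \<and>
    (\<forall>x\<in>F. \<forall>y\<in>F. x \<oplus>\<^bsub>A\<^esub> y \<in> F \<longrightarrow> \<delta> (x \<oplus>\<^bsub>A\<^esub> y) = \<delta> x \<oplus>\<^bsub>S\<^esub> \<delta> y) \<and>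
    (\<forall>x\<in>F. \<forall>y\<in>F. x \<otimes>\<^bsub>A\<^esub> y \<in> F \<longrightarrow> \<delta> (x \<otimes>\<^bsub>A\<^esub> y) = h x \<otimes>\<^bsub>S\<^esub> \<delta> y \<oplus>\<^bsub>S\<^esub> h y \<otimes>\<^bsub>S\<^esub> \<delta> x) \<and>
    (\<forall>c\<in>carrier k. c \<odot>\<^bsub>A\<^esub> \<one>\<^bsub>A\<^esub> \<in> F \<longrightarrow> \<delta> (c \<odot>\<^bsub>A\<^esub> \<one>\<^bsub>A\<^esub>) = \<zero>\<^bsub>S\<^esub>)"

text \<open>
  The linear map induced by \<open>\<delta>\<close>; meaningful only on elements of the free module supported on \<open>F\<close>.
\<close>

definition induced_map ::
  "('b, 'p) ring_scheme \<Rightarrow> ('a \<Rightarrow> 'b) \<Rightarrow> 'a set \<Rightarrow> ('a \<Rightarrow> 'b) \<Rightarrow> ('a \<Rightarrow> 'a) \<Rightarrow> 'b" where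
  "induced_map S h F \<delta> f = (\<Oplus>\<^bsub>S\<^esub>x\<in>F. h (f x) \<otimes>\<^bsub>S\<^esub> \<delta> x)"

context ring_hom_cring
begin

lemma induced_map_closed:
  assumes "\<delta> \<in> F \<rightarrow> carrier S" "f \<in> carrier (free_module R U)"
  shows "induced_map S h F \<delta> f \<in> carrier S"
  unfolding induced_map_def
  using assms(1) R.free_module_apply_closed[OF assms(2)] by (intro S.finsum_closed) auto

lemma induced_map_add:
  assumes "\<delta> \<in> F \<rightarrow> carrier S" "f \<in> carrier (free_module R U)" "g \<in> carrier (free_module R U)"
  shows "induced_map S h F \<delta> (f \<oplus>\<^bsub>free_module R U\<^esub> g) = induced_map S h F \<delta> f \<oplus>\<^bsub>S\<^esub> induced_map S h F \<delta> g"
proof -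
  note fg = R.free_module_apply_closed[OF assms(2)] R.free_module_apply_closed[OF assms(3)]
  have "induced_map S h F \<delta> (f \<oplus>\<^bsub>free_module R U\<^esub> g)
      = (\<Oplus>\<^bsub>S\<^esub>x\<in>F. h (f x) \<otimes>\<^bsub>S\<^esub> \<delta> x \<oplus>\<^bsub>S\<^esub> h (g x) \<otimes>\<^bsub>S\<^esub> \<delta> x)"
    unfolding induced_map_def using assms(1) fg
    by (intro S.finsum_cong') (auto simp: S.l_distr Pi_iff)
  also have "\<dots> = induced_map S h F \<delta> f \<oplus>\<^bsub>S\<^esub> induced_map S h F \<delta> g"
    unfolding induced_map_def using assms(1) fg by (intro S.finsum_addf) auto
  finally show ?thesis .
qed

lemma induced_map_smult:
  assumes "finite F" "\<delta> \<in> F \<rightarrow> carrier S" "f \<in> carrier (free_module R U)" "a \<in> carrier R"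
  shows "induced_map S h F \<delta> (a \<odot>\<^bsub>free_module R U\<^esub> f) = h a \<otimes>\<^bsub>S\<^esub> induced_map S h F \<delta> f"
proof -
  note f = R.free_module_apply_closed[OF assms(3)]
  have "h a \<otimes>\<^bsub>S\<^esub> induced_map S h F \<delta> f = (\<Oplus>\<^bsub>S\<^esub>x\<in>F. h a \<otimes>\<^bsub>S\<^esub> (h (f x) \<otimes>\<^bsub>S\<^esub> \<delta> x))"
    unfolding induced_map_def using assms f by (intro S.finsum_rdistr) auto
  also have "\<dots> = induced_map S h F \<delta> (a \<odot>\<^bsub>free_module R U\<^esub> f)"
    unfolding induced_map_def using assms(2,4) f
    by (intro S.finsum_cong') (auto simp: S.m_assoc Pi_iff)
  finally show ?thesis ..
qed

lemma induced_map_minus: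
  assumes "\<delta> \<in> F \<rightarrow> carrier S" "f \<in> carrier (free_module R U)" "g \<in> carrier (free_module R U)"
  shows "induced_map S h F \<delta> (f \<ominus>\<^bsub>free_module R U\<^esub> g) = induced_map S h F \<delta> f \<ominus>\<^bsub>S\<^esub> induced_map S h F \<delta> g"
proof -
  let ?F = "free_module R U"
  interpret F: module R ?F by (rule R.free_module_is_module)
  have fg: "f \<ominus>\<^bsub>?F\<^esub> g \<in> carrier ?F" using assms by (intro F.M.minus_closed)
  have "(f \<ominus>\<^bsub>?F\<^esub> g) \<oplus>\<^bsub>?F\<^esub> g = f"
    using F.M.minus_closed F.M.a_inv_closed assms(2,3) unfolding F.M.minus_eq
    by (metis F.M.a_assoc F.M.l_neg F.M.r_zero)
  then have eq: "induced_map S h F \<delta> f = induced_map S h F \<delta> (f \<ominus>\<^bsub>?F\<^esub> g) \<oplus>\<^bsub>S\<^esub> induced_map S h F \<delta> g"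
    using induced_map_add[OF assms(1) fg assms(3)] by simp
  have "p = p \<oplus>\<^bsub>S\<^esub> q \<ominus>\<^bsub>S\<^esub> q" if "p \<in> carrier S" "q \<in> carrier S" for p q
    using that by algebra
  then show ?thesis
    using induced_map_closed[OF assms(1) fg] induced_map_closed[OF assms(1,3)] unfolding eq by blast
qed

lemma induced_map_basis:
  assumes "finite F" "\<delta> \<in> F \<rightarrow> carrier S" "x \<in> F"
  shows "induced_map S h F \<delta> (basis_elt R x) = \<delta> x"
proof -
  have "induced_map S h F \<delta> (basis_elt R x) = (\<Oplus>\<^bsub>S\<^esub>y\<in>F. if x = y then \<delta> y else \<zero>\<^bsub>S\<^esub>)"
    unfolding induced_map_def basis_elt_def using assms by (intro S.finsum_cong') (auto dest: funcset_mem)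
  also have "\<dots> = \<delta> x" using assms by (intro S.finsum_singleton) auto
  finally show ?thesis .
qed

end

text \<open>
  Only finitely many relations are involved in \<open>d a = 0\<close>, so this already follows for derivations
  that are defined on a sufficiently large finite set.
\<close>

lemma (in algebra) partial_derivation_vanishes:
  assumes zero: "zero_module (kaehler_differentials R M)"
    and hom: "ring_hom_cring M S h" and a: "a \<in> carrier M"
  shows "\<exists>F0. finite F0 \<and> F0 \<subseteq> carrier M \<and>
    (\<forall>F \<delta>. finite F \<longrightarrow> F0 \<subseteq> F \<longrightarrow> F \<subseteq> carrier M \<longrightarrow> partial_derivation R M S h F \<delta> \<longrightarrow> \<delta> a = \<zero>\<^bsub>S\<^esub>)"
proof -
  interpret h: ring_hom_cring M S h by (rule hom)
  let ?F = "free_module M (carrier M)"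
  let ?d = "basis_elt M"
  interpret F: module M ?F by (rule cring.free_module_is_module[OF M_cring])
  \<comment> \<open>For a sum, the sets \<open>F0\<close> of the summands can be united, so the
    elements that admit some \<open>F0\<close> form a submodule. It contains the relations, hence
    everything when Omega is zero.\<close>
  define vanish where "vanish f F0 \<longleftrightarrow> finite F0 \<and> F0 \<subseteq> carrier M \<and> (\<forall>F \<delta>. finite F \<longrightarrow> F0 \<subseteq> F \<longrightarrow>
    F \<subseteq> carrier M \<longrightarrow> partial_derivation R M S h F \<delta> \<longrightarrow> induced_map S h F \<delta> f = \<zero>\<^bsub>S\<^esub>)" for f F0
  define N where "N = {f \<in> carrier ?F. \<exists>F0. vanish f F0}"
  have pd: "\<delta> \<in> F \<rightarrow> carrier S" if "partial_derivation R M S h F \<delta>" for F \<delta>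
    using that by (auto simp: partial_derivation_def)
  have smult: "c \<odot>\<^bsub>?F\<^esub> f \<in> N" if c: "c \<in> carrier M" and f: "f \<in> N" for c f
  proof -
    obtain F0 where F0: "vanish f F0" and fF: "f \<in> carrier ?F" using f by (auto simp: N_def)
    then have "vanish (c \<odot>\<^bsub>?F\<^esub> f) F0"
      unfolding vanish_def using h.induced_map_smult[OF _ pd fF c] c by simp
    then show ?thesis unfolding N_def using F.smult_closed[OF c fF] by blast
  qed
  have sub: "submodule N M ?F"
  proof (rule F.submoduleI)
    show "N \<subseteq> carrier ?F" by (auto simp: N_def)
    have "vanish \<zero>\<^bsub>?F\<^esub> {}"
      unfolding vanish_def
    proof (intro conjI allI impI)
      fix F \<delta> assume F: "finite F" "F \<subseteq> carrier M" "partial_derivation R M S h F \<delta>"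
      have "induced_map S h F \<delta> \<zero>\<^bsub>?F\<^esub> = induced_map S h F \<delta> (\<zero>\<^bsub>M\<^esub> \<odot>\<^bsub>?F\<^esub> \<zero>\<^bsub>?F\<^esub>)" by simp
      also have "\<dots> = \<zero>\<^bsub>S\<^esub>"
        using h.induced_map_smult[OF F(1) pd[OF F(3)] F.M.zero_closed ring.ring_simprules(2)[OF cring.axioms(1)[OF M_cring]]]
          h.induced_map_closed[OF pd[OF F(3)] F.M.zero_closed] by simp
      finally show "induced_map S h F \<delta> \<zero>\<^bsub>?F\<^esub> = \<zero>\<^bsub>S\<^esub>" .
    qed auto
    then show "\<zero>\<^bsub>?F\<^esub> \<in> N" unfolding N_def using F.M.zero_closed by blast
  next
    fix f assume f: "f \<in> N"
    then have "f \<in> carrier ?F" by (simp add: N_def)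
    then have "(\<ominus>\<^bsub>M\<^esub> \<one>\<^bsub>M\<^esub>) \<odot>\<^bsub>?F\<^esub> f = \<ominus>\<^bsub>?F\<^esub> f"
      using F.smult_l_minus[of "\<one>\<^bsub>M\<^esub>" f] F.smult_one by simp
    then show "\<ominus>\<^bsub>?F\<^esub> f \<in> N" using smult[OF _ f, of "\<ominus>\<^bsub>M\<^esub> \<one>\<^bsub>M\<^esub>"] by simp
  next
    fix f g assume "f \<in> N" "g \<in> N"
    then obtain F0 G0 where F0: "vanish f F0" "vanish g G0" and fg: "f \<in> carrier ?F" "g \<in> carrier ?F"
      by (auto simp: N_def)
    then have "vanish (f \<oplus>\<^bsub>?F\<^esub> g) (F0 \<union> G0)"
      unfolding vanish_def using h.induced_map_add[OF pd fg] by simp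
    then show "f \<oplus>\<^bsub>?F\<^esub> g \<in> N" unfolding N_def using F.M.a_closed[OF fg] by blast
  qed (rule smult)
  have d: "?d x \<in> carrier ?F" if "x \<in> carrier M" for x
    using that by (rule cring.basis_elt_closed[OF M_cring])
  have "kaehler_relations R M \<subseteq> N"
  proof -
    have "?d (x \<oplus>\<^bsub>M\<^esub> y) \<ominus>\<^bsub>?F\<^esub> (?d x \<oplus>\<^bsub>?F\<^esub> ?d y) \<in> N" if x: "x \<in> carrier M" and y: "y \<in> carrier M" for x y
    proof -
      have xy: "x \<oplus>\<^bsub>M\<^esub> y \<in> carrier M" using x y by simp
      \<comment> \<open>The witness collects the symbols that occur in the relation, so that the law
        in question is available on every larger set.\<close>
      have "vanish (?d (x \<oplus>\<^bsub>M\<^esub> y) \<ominus>\<^bsub>?F\<^esub> (?d x \<oplus>\<^bsub>?F\<^esub> ?d y)) {x, y, x \<oplus>\<^bsub>M\<^esub> y}"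
        unfolding vanish_def
      proof (intro conjI allI impI)
        fix F \<delta> assume F: "finite F" "{x, y, x \<oplus>\<^bsub>M\<^esub> y} \<subseteq> F" "F \<subseteq> carrier M" "partial_derivation R M S h F \<delta>"
        note \<delta> = pd[OF F(4)]
        have "\<delta> (x \<oplus>\<^bsub>M\<^esub> y) = \<delta> x \<oplus>\<^bsub>S\<^esub> \<delta> y" using F(2,4) by (auto simp: partial_derivation_def)
        then show "induced_map S h F \<delta> (?d (x \<oplus>\<^bsub>M\<^esub> y) \<ominus>\<^bsub>?F\<^esub> (?d x \<oplus>\<^bsub>?F\<^esub> ?d y)) = \<zero>\<^bsub>S\<^esub>"
          unfolding h.induced_map_minus[OF \<delta> d[OF xy] F.M.a_closed[OF d[OF x] d[OF y]]]
            h.induced_map_add[OF \<delta> d[OF x] d[OF y]]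
          using h.induced_map_basis[OF F(1) \<delta>] F(2) \<delta> by (auto simp: Pi_iff h.S.r_neg h.S.minus_eq)
      qed (use x y in auto)
      then show ?thesis unfolding N_def
        using F.M.minus_closed[OF d[OF xy] F.M.a_closed[OF d[OF x] d[OF y]]] by blast
    qed
    moreover have "?d (x \<otimes>\<^bsub>M\<^esub> y) \<ominus>\<^bsub>?F\<^esub> (x \<odot>\<^bsub>?F\<^esub> ?d y \<oplus>\<^bsub>?F\<^esub> y \<odot>\<^bsub>?F\<^esub> ?d x) \<in> N" if x: "x \<in> carrier M" and y: "y \<in> carrier M" for x y
    proof -
      have xy: "x \<otimes>\<^bsub>M\<^esub> y \<in> carrier M" using x y by simp
      note c = F.smult_closed[OF x d[OF y]] F.smult_closed[OF y d[OF x]]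
      have "vanish (?d (x \<otimes>\<^bsub>M\<^esub> y) \<ominus>\<^bsub>?F\<^esub> (x \<odot>\<^bsub>?F\<^esub> ?d y \<oplus>\<^bsub>?F\<^esub> y \<odot>\<^bsub>?F\<^esub> ?d x)) {x, y, x \<otimes>\<^bsub>M\<^esub> y}"
        unfolding vanish_def
      proof (intro conjI allI impI)
        fix F \<delta> assume F: "finite F" "{x, y, x \<otimes>\<^bsub>M\<^esub> y} \<subseteq> F" "F \<subseteq> carrier M" "partial_derivation R M S h F \<delta>"
        note \<delta> = pd[OF F(4)]
        have "\<delta> (x \<otimes>\<^bsub>M\<^esub> y) = h x \<otimes>\<^bsub>S\<^esub> \<delta> y \<oplus>\<^bsub>S\<^esub> h y \<otimes>\<^bsub>S\<^esub> \<delta> x" using F(2,4) by (auto simp: partial_derivation_def)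
        then show "induced_map S h F \<delta> (?d (x \<otimes>\<^bsub>M\<^esub> y) \<ominus>\<^bsub>?F\<^esub> (x \<odot>\<^bsub>?F\<^esub> ?d y \<oplus>\<^bsub>?F\<^esub> y \<odot>\<^bsub>?F\<^esub> ?d x)) = \<zero>\<^bsub>S\<^esub>"
          unfolding h.induced_map_minus[OF \<delta> d[OF xy] F.M.a_closed[OF c]]
            h.induced_map_add[OF \<delta> c] h.induced_map_smult[OF F(1) \<delta> d[OF x] y] h.induced_map_smult[OF F(1) \<delta> d[OF y] x]
          using h.induced_map_basis[OF F(1) \<delta>] F(2) \<delta> x y by (auto simp: Pi_iff h.S.r_neg h.S.minus_eq)
      qed (use x y in auto)
      then show ?thesis unfolding N_def
        using F.M.minus_closed[OF d[OF xy] F.M.a_closed[OF c]] by blast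
    qed
    moreover have "?d (c \<odot>\<^bsub>M\<^esub> \<one>\<^bsub>M\<^esub>) \<in> N" if c: "c \<in> carrier R" for c
    proof -
      have c1: "c \<odot>\<^bsub>M\<^esub> \<one>\<^bsub>M\<^esub> \<in> carrier M" using c by simp
      have "vanish (?d (c \<odot>\<^bsub>M\<^esub> \<one>\<^bsub>M\<^esub>)) {c \<odot>\<^bsub>M\<^esub> \<one>\<^bsub>M\<^esub>}"
        unfolding vanish_def
      proof (intro conjI allI impI)
        fix F \<delta> assume F: "finite F" "{c \<odot>\<^bsub>M\<^esub> \<one>\<^bsub>M\<^esub>} \<subseteq> F" "F \<subseteq> carrier M" "partial_derivation R M S h F \<delta>"
        show "induced_map S h F \<delta> (?d (c \<odot>\<^bsub>M\<^esub> \<one>\<^bsub>M\<^esub>)) = \<zero>\<^bsub>S\<^esub>"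
          using h.induced_map_basis[OF F(1) pd[OF F(4)]] F(2,4) c by (auto simp: partial_derivation_def)
      qed (use c1 in auto)
      then show ?thesis unfolding N_def using d[OF c1] by blast
    qed
    ultimately show ?thesis unfolding kaehler_relations_def Let_def by blast
  qed
  then have "kaehler_submodule R M \<subseteq> N"
    unfolding kaehler_submodule_def span_submodule_def using sub by (intro hull_minimal)
  then have "?d a \<in> N" using zero d[OF a] unfolding zero_kaehler_iff by blast
  then obtain F0 where F0: "vanish (?d a) F0" by (auto simp: N_def)
  show ?thesis
  \<comment> \<open>With \<open>a\<close> in the set, the induced map sends the symbol of
    \<open>a\<close> to its value under the derivation.\<close>
  proof (intro exI[of _ "insert a F0"] conjI allI impI)
    fix F \<delta> assume F: "finite F" "insert a F0 \<subseteq> F" "F \<subseteq> carrier M" "partial_derivation R M S h F \<delta>"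
    have "\<delta> a = induced_map S h F \<delta> (?d a)" using h.induced_map_basis[OF F(1) pd[OF F(4)], of a] F(2) by simp
    also have "\<dots> = \<zero>\<^bsub>S\<^esub>" using F0 F unfolding vanish_def by simp
    finally show "\<delta> a = \<zero>\<^bsub>S\<^esub>" .
  qed (use F0 a in \<open>auto simp: vanish_def\<close>)
qed

section \<open>Integrality\<close>

definition integral_over :: "('a, 'm) ring_scheme \<Rightarrow> 'a set \<Rightarrow> 'a \<Rightarrow> bool" where
  "integral_over R K x \<longleftrightarrow>
    (\<exists>p. p \<noteq> [] \<and> set p \<subseteq> K \<and> last p = \<one>\<^bsub>R\<^esub> \<and> peval R p x = \<zero>\<^bsub>R\<^esub>)"

text \<open>
  The image of a field of characteristic zero in a ring; in this form the zero ring needs no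
  special treatment.
\<close>

definition char_zero_field_image :: "('a, 'm) ring_scheme \<Rightarrow> 'a set \<Rightarrow> bool" where
  "char_zero_field_image R K \<longleftrightarrow> subring K R \<and>
    (\<forall>c\<in>K. c \<noteq> \<zero>\<^bsub>R\<^esub> \<longrightarrow> (\<exists>d\<in>K. c \<otimes>\<^bsub>R\<^esub> d = \<one>\<^bsub>R\<^esub>)) \<and>
    (\<forall>n::nat. n > 0 \<longrightarrow> (\<exists>d\<in>K. ([n] \<cdot>\<^bsub>R\<^esub> \<one>\<^bsub>R\<^esub>) \<otimes>\<^bsub>R\<^esub> d = \<one>\<^bsub>R\<^esub>))"

lemma (in algebra) char_zero_field_image_scalars:
  assumes "field R" "char_zero R"
  shows "char_zero_field_image M ((\<lambda>c. c \<odot>\<^bsub>M\<^esub> \<one>\<^bsub>M\<^esub>) ` carrier R)"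
proof -
  interpret k: field R by (rule assms(1))
  let ?i = "\<lambda>c. c \<odot>\<^bsub>M\<^esub> \<one>\<^bsub>M\<^esub>"
  have hom: "?i \<in> ring_hom R M"
    by (auto simp: ring_hom_def smult_l_distr smult_assoc1 smult_assoc2)
  interpret i: ring_hom_ring R M ?i
    using hom by (intro ring_hom_ringI2 field.is_ring[OF assms(1)] cring.axioms(1)[OF M_cring])
  have unit: "\<exists>d\<in>?i ` carrier R. ?i c \<otimes>\<^bsub>M\<^esub> d = \<one>\<^bsub>M\<^esub>" if "c \<in> carrier R" "c \<noteq> \<zero>" for c
  proof -
    have c: "inv c \<in> carrier R" "c \<otimes> inv c = \<one>"
      using that k.field_Units by auto
    then have "?i c \<otimes>\<^bsub>M\<^esub> ?i (inv c) = \<one>\<^bsub>M\<^esub>"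
      using i.hom_mult[OF that(1) c(1)] i.hom_one by simp
    then show ?thesis using c(1) by blast
  qed
  have nat: "?i ([n] \<cdot> \<one>) = [n] \<cdot>\<^bsub>M\<^esub> \<one>\<^bsub>M\<^esub>" for n :: nat
    by (induction n) (auto simp: smult_l_distr)
  show ?thesis
    unfolding char_zero_field_image_def
  proof (intro conjI ballI allI impI)
    show "subring (?i ` carrier R) M" by (rule i.img_is_subring[OF ring.carrier_is_subring[OF field.is_ring[OF assms(1)]]])
    show "\<exists>d\<in>?i ` carrier R. c \<otimes>\<^bsub>M\<^esub> d = \<one>\<^bsub>M\<^esub>" if c: "c \<in> ?i ` carrier R" "c \<noteq> \<zero>\<^bsub>M\<^esub>" for c
    proof -
      obtain c' where c': "c' \<in> carrier R" "c = ?i c'" using c(1) by blast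
      then have "c' \<noteq> \<zero>" using c(2) by auto
      then show ?thesis using unit[OF c'(1)] c'(2) by simp
    qed
    show "\<exists>d\<in>?i ` carrier R. ([n] \<cdot>\<^bsub>M\<^esub> \<one>\<^bsub>M\<^esub>) \<otimes>\<^bsub>M\<^esub> d = \<one>\<^bsub>M\<^esub>" if "n > 0" for n :: nat
    proof -
      have "[n] \<cdot> \<one> \<noteq> \<zero>" using assms(2) that unfolding char_zero_def by blast
      then show ?thesis using unit[of "[n] \<cdot> \<one>"] unfolding nat by simp
    qed
  qed
qed

lemma (in ring_hom_ring) peval_hom:
  assumes "set p \<subseteq> carrier R" "x \<in> carrier R" "cring R"
  shows "peval S (map h p) (h x) = h (peval R p x)"
proof -
  interpret cring R by (rule assms(3))
  show ?thesis using assms(1,2) by (induction p) auto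
qed

section \<open>Monic polynomials and prime ideals that avoid a multiplicative set\<close>

context cring
begin

text \<open>Induction along (c + x p) q = c q + x (p q). The bound on the length of r makes the term
  c q shorter than the shifted r, so the leading one comes from r alone.\<close>

lemma monic_mult:
  assumes K: "subring K R" and x: "x \<in> carrier R"
    and q: "q \<noteq> []" "set q \<subseteq> K" "last q = \<one>"
    and p: "p \<noteq> []" "set p \<subseteq> K" "last p = \<one>"
  shows "\<exists>r. set r \<subseteq> K \<and> last r = \<one> \<and> length q \<le> length r \<and> peval R r x = peval R p x \<otimes> peval R q x"
  using p
proof (induction p)
  case (Cons c p)
  note Ks = subringE[OF K]
  have qc: "set q \<subseteq> carrier R" using q(2) Ks(1) by blast
  then have qx: "peval R q x \<in> carrier R" using x by simp
  show ?case
  proof (cases "p = []")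
    case True
    then have "peval R (c # p) x \<otimes> peval R q x = peval R q x" using qx x Cons(4) by simp
    then show ?thesis using q(2,3) by (intro exI[of _ q]) auto
  next
    case False
    then obtain r where r: "set r \<subseteq> K" "last r = \<one>" "length q \<le> length r"
        "peval R r x = peval R p x \<otimes> peval R q x"
      using Cons by auto
    have pc: "set p \<subseteq> carrier R" "c \<in> K" "c \<in> carrier R" using Cons(3) Ks(1) by auto
    have rc: "set r \<subseteq> carrier R" using r(1) Ks(1) by blast
    have "r \<noteq> []" using r(3) q(1) by auto
    let ?r = "padd R (map (\<lambda>a. c \<otimes> a) q) (\<zero> # r)"
    have cq: "set (map (\<lambda>a. c \<otimes> a) q) \<subseteq> K" using q(2) pc(2) Ks(6) by auto
    have "set ?r \<subseteq> K" using cq r(1) Ks(2) by (intro set_padd_subring[OF K]) auto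
    moreover have "last ?r = \<one>" using r(2,3) \<open>r \<noteq> []\<close> by (subst last_padd_longer) auto
    moreover have "length q \<le> length ?r" by simp
    moreover have "peval R ?r x = peval R (c # p) x \<otimes> peval R q x"
    proof -
      have "peval R ?r x = c \<otimes> peval R q x \<oplus> x \<otimes> (peval R p x \<otimes> peval R q x)"
        using peval_padd[of "map (\<lambda>a. c \<otimes> a) q" "\<zero> # r" x] cq rc x Ks(1)
          peval_smult[OF qc pc(3) x] r(4) peval_closed[OF pc(1) x] qx by auto
      also have "\<dots> = peval R (c # p) x \<otimes> peval R q x"
        using pc(3) x peval_closed[OF pc(1) x] qx by (simp, algebra)
      finally show ?thesis .
    qed
    ultimately show ?thesis by blast
  qed
qed auto

text \<open>An ideal maximal among those disjoint from \<open>S\<close>, obtained by Zorn's lemma,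
  is prime.\<close>

lemma prime_ideal_avoiding:
  assumes S: "S \<subseteq> carrier R" "\<one> \<in> S" "\<zero> \<notin> S" "\<And>x y. x \<in> S \<Longrightarrow> y \<in> S \<Longrightarrow> x \<otimes> y \<in> S"
  shows "\<exists>P. primeideal P R \<and> P \<inter> S = {}"
proof -
  define \<A> where "\<A> = {I. ideal I R \<and> I \<inter> S = {}}"
  have "\<exists>P\<in>\<A>. \<forall>I\<in>\<A>. P \<subseteq> I \<longrightarrow> I = P"
  proof (rule subset_Zorn_nonempty)
    show "\<A> \<noteq> {}" using zeroideal S(3) by (auto simp: \<A>_def)
    fix \<C> assume ne: "\<C> \<noteq> {}" and ch: "subset.chain \<A> \<C>"
    have id: "ideal I R" if "I \<in> \<C>" for I using ch that by (auto simp: subset.chain_def \<A>_def)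
    have tot: "I \<subseteq> J \<or> J \<subseteq> I" if "I \<in> \<C>" "J \<in> \<C>" for I J
      using ch that unfolding subset_chain_def by blast
    have common: "\<exists>K\<in>\<C>. x \<in> K \<and> y \<in> K" if "x \<in> \<Union>\<C>" "y \<in> \<Union>\<C>" for x y
      using that tot by blast
    have "ideal (\<Union>\<C>) R"
    proof (rule idealI[OF ring_axioms])
      show "subgroup (\<Union>\<C>) (add_monoid R)"
      proof (rule add.subgroupI)
        show "\<Union>\<C> \<subseteq> carrier R" using ideal.Icarr[OF id] by blast
        obtain I where "I \<in> \<C>" using ne by blast
        then show "\<Union>\<C> \<noteq> {}" using additive_subgroup.zero_closed[OF ideal.axioms(1)[OF id]] by blast
      next
        fix x assume "x \<in> \<Union>\<C>"
        then obtain I where "I \<in> \<C>" "x \<in> I" by blast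
        then show "\<ominus> x \<in> \<Union>\<C>"
          using additive_subgroup.a_inv_closed[OF ideal.axioms(1)[OF id]] by blast
      next
        fix x y assume "x \<in> \<Union>\<C>" "y \<in> \<Union>\<C>"
        then obtain I where "I \<in> \<C>" "x \<in> I" "y \<in> I" using common by blast
        then show "x \<oplus> y \<in> \<Union>\<C>"
          using additive_subgroup.a_closed[OF ideal.axioms(1)[OF id]] by blast
      qed
    next
      fix x r assume "x \<in> \<Union>\<C>" and r: "r \<in> carrier R"
      then obtain I where I: "I \<in> \<C>" "x \<in> I" by blast
      show "r \<otimes> x \<in> \<Union>\<C>" using ideal.I_l_closed[OF id[OF I(1)] I(2) r] I(1) by blast
      show "x \<otimes> r \<in> \<Union>\<C>" using ideal.I_r_closed[OF id[OF I(1)] I(2) r] I(1) by blast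
    qed
    moreover have "\<Union>\<C> \<inter> S = {}" using ch by (auto simp: subset.chain_def \<A>_def)
    ultimately show "\<Union>\<C> \<in> \<A>" by (simp add: \<A>_def)
  qed
  then obtain P where P: "ideal P R" "P \<inter> S = {}" and max: "\<And>I. ideal I R \<Longrightarrow> I \<inter> S = {} \<Longrightarrow> P \<subseteq> I \<Longrightarrow> I = P"
    by (auto simp: \<A>_def)
  interpret P: ideal P R by (rule P(1))
  \<comment> \<open>By maximality, the ideal generated by \<open>P\<close> and an element outside
    \<open>P\<close> meets \<open>S\<close>.\<close>
  have meet: "\<exists>p\<in>P. \<exists>r\<in>carrier R. p \<oplus> r \<otimes> a \<in> S" if a: "a \<in> carrier R" "a \<notin> P" for a
  proof (rule ccontr)
    assume *: "\<not> ?thesis"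
    let ?I = "P <+>\<^bsub>R\<^esub> PIdl a"
    have I: "?I = {p \<oplus> r \<otimes> a | p r. p \<in> P \<and> r \<in> carrier R}"
      by (auto simp: set_add_defs cgenideal_def)
    have "ideal ?I R" by (intro add_ideals P(1) cgenideal_ideal a(1))
    moreover have "?I \<inter> S = {}" using * by (auto simp: I)
    moreover have "P \<subseteq> ?I"
    proof
      fix p assume p: "p \<in> P"
      then have "p = p \<oplus> \<zero> \<otimes> a" using a(1) P.Icarr by simp
      then show "p \<in> ?I" using p unfolding I by blast
    qed
    ultimately have "?I = P" by (rule max)
    moreover have "a \<in> ?I"
    proof -
      have "a = \<zero> \<oplus> \<one> \<otimes> a" using a(1) by simp
      then show ?thesis using P.zero_closed unfolding I by blast
    qed
    ultimately show False using a(2) by simp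
  qed
  have "primeideal P R"
  proof (rule primeidealI[OF P(1) is_cring])
    show "carrier R \<noteq> P" using S(2) P(2) by auto
    fix a b assume a: "a \<in> carrier R" and b: "b \<in> carrier R" and ab: "a \<otimes> b \<in> P"
    show "a \<in> P \<or> b \<in> P"
    proof (rule ccontr)
      assume "\<not> (a \<in> P \<or> b \<in> P)"
      then obtain p q r s where p: "p \<in> P" "r \<in> carrier R" "p \<oplus> r \<otimes> a \<in> S"
          and q: "q \<in> P" "s \<in> carrier R" "q \<oplus> s \<otimes> b \<in> S"
        using meet[OF a] meet[OF b] by blast
      have c: "p \<in> carrier R" "q \<in> carrier R" using p(1) q(1) P.Icarr by auto
      \<comment> \<open>The product of the two elements of \<open>S\<close> is again in
        \<open>S\<close>, but each term of its expansion lies in \<open>P\<close>.\<close>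
      have "(p \<oplus> r \<otimes> a) \<otimes> (q \<oplus> s \<otimes> b) = p \<otimes> (q \<oplus> s \<otimes> b) \<oplus> (r \<otimes> a) \<otimes> q \<oplus> (r \<otimes> s) \<otimes> (a \<otimes> b)"
        using a b c p(2) q(2) by algebra
      also have "\<dots> \<in> P"
        using P.I_r_closed[OF p(1), of "q \<oplus> s \<otimes> b"] P.I_l_closed[OF q(1), of "r \<otimes> a"]
          P.I_l_closed[OF ab, of "r \<otimes> s"] a b c p(2) q(2) by (intro P.a_closed) auto
      finally show False using S(4)[OF p(3) q(3)] P(2) by blast
    qed
  qed
  then show ?thesis using P(2) by blast
qed

end

lemma (in algebra) integral_if_zero_kaehler:
  assumes k: "field R" "char_zero R"
    and zero: "zero_module (kaehler_differentials R M)" and a: "a \<in> carrier M"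
  shows "integral_over M ((\<lambda>c. c \<odot>\<^bsub>M\<^esub> \<one>\<^bsub>M\<^esub>) ` carrier R) a"
proof (rule ccontr)
  define K where "K = (\<lambda>c. c \<odot>\<^bsub>M\<^esub> \<one>\<^bsub>M\<^esub>) ` carrier R"
  assume "\<not> ?thesis"
  then have not_int: "\<not> integral_over M K a" by (simp add: K_def)
  have K: "subring K M" and inv: "\<And>c. c \<in> K \<Longrightarrow> c \<noteq> \<zero>\<^bsub>M\<^esub> \<Longrightarrow> \<exists>d\<in>K. c \<otimes>\<^bsub>M\<^esub> d = \<one>\<^bsub>M\<^esub>"
    and nat: "\<And>n::nat. n > 0 \<Longrightarrow> \<exists>d\<in>K. ([n] \<cdot>\<^bsub>M\<^esub> \<one>\<^bsub>M\<^esub>) \<otimes>\<^bsub>M\<^esub> d = \<one>\<^bsub>M\<^esub>"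
    using char_zero_field_image_scalars[OF k] by (auto simp: K_def char_zero_field_image_def)
  note Ks = subringE[OF K]
  \<comment> \<open>That zero is not in \<open>S\<close> is exactly the non-integrality of
    \<open>a\<close>.\<close>
  define S where "S = {peval M p a | p. p \<noteq> [] \<and> set p \<subseteq> K \<and> last p = \<one>\<^bsub>M\<^esub>}"
  have "\<exists>P. primeideal P M \<and> P \<inter> S = {}"
  proof (rule cring.prime_ideal_avoiding[OF M_cring])
    show "S \<subseteq> carrier M"
      using Ks(1) a unfolding S_def by (auto intro!: cring.peval_closed[OF M_cring])
    have "peval M [\<one>\<^bsub>M\<^esub>] a = \<one>\<^bsub>M\<^esub>" using a by simp
    then show "\<one>\<^bsub>M\<^esub> \<in> S" unfolding S_def using Ks(3) by (intro CollectI exI[of _ "[\<one>\<^bsub>M\<^esub>]"]) auto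
    show "\<zero>\<^bsub>M\<^esub> \<notin> S" using not_int unfolding S_def integral_over_def by force
    fix x y assume "x \<in> S" "y \<in> S"
    then obtain p q where p: "p \<noteq> []" "set p \<subseteq> K" "last p = \<one>\<^bsub>M\<^esub>" "x = peval M p a"
      and q: "q \<noteq> []" "set q \<subseteq> K" "last q = \<one>\<^bsub>M\<^esub>" "y = peval M q a" unfolding S_def by blast
    obtain r where r: "set r \<subseteq> K" "last r = \<one>\<^bsub>M\<^esub>" "length q \<le> length r" "peval M r a = x \<otimes>\<^bsub>M\<^esub> y"
      using cring.monic_mult[OF M_cring K a q(1-3) p(1-3)] unfolding p(4) q(4) by blast
    then have "r \<noteq> []" using q(1) by auto
    then show "x \<otimes>\<^bsub>M\<^esub> y \<in> S" unfolding S_def r(4)[symmetric] using r(1,2) by blast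
  qed
  then obtain P where P: "primeideal P M" "P \<inter> S = {}" by blast
  interpret P: primeideal P M by (rule P(1))
  define D where "D = M Quot P"
  define h where "h = (+>\<^bsub>M\<^esub>) P"
  have hom: "ring_hom_cring M D h" unfolding D_def h_def by (rule P.rcos_ring_hom_cring)
  interpret D: domain D unfolding D_def by (rule P.quotient_is_domain)
  interpret h: ring_hom_cring M D h by (rule hom)
  have h0: "x \<in> P" if "x \<in> carrier M" "h x = \<zero>\<^bsub>D\<^esub>" for x
    using P.rcos_const_imp_mem[OF that(1)] that(2) by (simp add: h_def D_def FactRing_def)
  have hK: "subring (h ` K) D" by (rule h.ring.img_is_subring[OF K])
  have trans: "peval D f (h a) \<noteq> \<zero>\<^bsub>D\<^esub>" if f: "f \<noteq> []" "set f \<subseteq> h ` K" "last f \<noteq> \<zero>\<^bsub>D\<^esub>" for f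
  proof
    assume f0: "peval D f (h a) = \<zero>\<^bsub>D\<^esub>"
    have "f \<in> map h ` lists K" using f(2) by (auto simp flip: lists_image)
    then obtain p where p: "set p \<subseteq> K" "f = map h p" by auto
    have pc: "set p \<subseteq> carrier M" using p(1) Ks(1) by blast
    have ne: "p \<noteq> []" using p f by auto
    then have "last p \<in> K" using p(1) last_in_set by blast
    moreover have "last p \<noteq> \<zero>\<^bsub>M\<^esub>" using f(3) ne unfolding p(2) by (auto simp: last_map)
    ultimately obtain d where d: "d \<in> K" "last p \<otimes>\<^bsub>M\<^esub> d = \<one>\<^bsub>M\<^esub>" using inv by blast
    have dc: "d \<in> carrier M" using d(1) Ks(1) by blast
    \<comment> \<open>A nonzero leading coefficient in \<open>K\<close> is invertible, so the
      relation can be made monic; its value at \<open>a\<close> would then lie in both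
      \<open>S\<close> and \<open>P\<close>.\<close>
    let ?q = "map (\<lambda>c. d \<otimes>\<^bsub>M\<^esub> c) p"
    have "last ?q = \<one>\<^bsub>M\<^esub>"
      using d(2) dc ne pc comm_monoid.m_comm[OF cring.axioms(2)[OF M_cring], of d "last p"] by (simp add: last_map subset_iff)
    moreover have "set ?q \<subseteq> K" using p(1) d(1) Ks(6) by auto
    ultimately have "peval M ?q a \<in> S" unfolding S_def using ne by blast
    moreover have eq: "peval M ?q a = d \<otimes>\<^bsub>M\<^esub> peval M p a" by (rule cring.peval_smult[OF M_cring pc dc a])
    have pa: "peval M p a \<in> carrier M" by (rule cring.peval_closed[OF M_cring pc a])
    have "h (peval M ?q a) = \<zero>\<^bsub>D\<^esub>"
      using f0 dc pa h.ring.peval_hom[OF pc a M_cring] unfolding eq p(2) by simp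
    then have "peval M ?q a \<in> P" using h0 eq dc pa by simp
    ultimately show False using P(2) by blast
  qed
  have hnat: "h ([n] \<cdot>\<^bsub>M\<^esub> \<one>\<^bsub>M\<^esub>) = [n] \<cdot>\<^bsub>D\<^esub> \<one>\<^bsub>D\<^esub>" for n :: nat by (induction n) auto
  \<comment> \<open>The inverse of n in \<open>K\<close> is still an inverse of n in the
    quotient.\<close>
  have char0: "[n] \<cdot>\<^bsub>D\<^esub> \<one>\<^bsub>D\<^esub> \<noteq> \<zero>\<^bsub>D\<^esub>" if n: "n > 0" for n :: nat
  proof
    assume "[n] \<cdot>\<^bsub>D\<^esub> \<one>\<^bsub>D\<^esub> = \<zero>\<^bsub>D\<^esub>"
    moreover obtain d where d: "d \<in> K" "([n] \<cdot>\<^bsub>M\<^esub> \<one>\<^bsub>M\<^esub>) \<otimes>\<^bsub>M\<^esub> d = \<one>\<^bsub>M\<^esub>" using nat[OF n] by blast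
    moreover have "d \<in> carrier M" using d(1) Ks(1) by blast
    ultimately have "\<one>\<^bsub>D\<^esub> = \<zero>\<^bsub>D\<^esub>"
      using h.hom_mult[of "[n] \<cdot>\<^bsub>M\<^esub> \<one>\<^bsub>M\<^esub>" d] h.hom_one hnat[of n] by simp
    then show False using D.one_not_zero by simp
  qed
  obtain F0 where F0: "finite F0" "F0 \<subseteq> carrier M"
    and vanish: "\<And>F \<delta>. finite F \<Longrightarrow> F0 \<subseteq> F \<Longrightarrow> F \<subseteq> carrier M \<Longrightarrow> partial_derivation R M D h F \<delta> \<Longrightarrow> \<delta> a = \<zero>\<^bsub>D\<^esub>"
    using partial_derivation_vanishes[OF zero hom a] by blast
  define F where "F = insert a F0"
  have F: "finite F" "F \<subseteq> carrier M" using F0 a by (auto simp: F_def)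
  have "finite (h ` F)" "h ` F \<subseteq> carrier D" using F h.hom_closed by auto
  then obtain H y where H: "derivation_graph D H" "h ` K \<times> {\<zero>\<^bsub>D\<^esub>} \<subseteq> H" "(h a, y) \<in> H" "y \<noteq> \<zero>\<^bsub>D\<^esub>"
      "h ` F \<subseteq> fst ` H"
    using D.derivation_graph_extend_finite[OF char0 hK h.hom_closed[OF a] trans, of "h ` F"] by blast
  have Hs: "subring H (dual D)" using H(1) by (simp add: derivation_graph_def)
  note Hs' = subringE[OF Hs]
  have unique: "z = w" if zw: "(u, z) \<in> H" "(u, w) \<in> H" for u z w
  proof -
    have c: "u \<in> carrier D" "z \<in> carrier D" "w \<in> carrier D" using Hs'(1) zw by auto
    have "(u, z) \<oplus>\<^bsub>dual D\<^esub> (\<ominus>\<^bsub>dual D\<^esub> (u, w)) \<in> H" using zw Hs'(5,7) by blast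
    then have "(\<zero>\<^bsub>D\<^esub>, z \<ominus>\<^bsub>D\<^esub> w) \<in> H" using c by (simp add: D.dual_uminus D.r_neg D.minus_eq)
    then have "z \<ominus>\<^bsub>D\<^esub> w = \<zero>\<^bsub>D\<^esub>" using H(1) by (auto simp: derivation_graph_def)
    then show ?thesis using c by simp
  qed
  \<comment> \<open>The derivation lives on the first projection of \<open>H\<close>, a subring of
    \<open>D\<close>; preceded by \<open>h\<close> it becomes a derivation on
    \<open>F\<close>.\<close>
  define \<delta> where "\<delta> b = (THE z. (h b, z) \<in> H)" for b
  have \<delta>_eq: "\<delta> b = z" if "(h b, z) \<in> H" for b z
    unfolding \<delta>_def by (rule the_equality, rule that, rule unique[OF _ that])
  have \<delta>: "(h b, \<delta> b) \<in> H" if b: "b \<in> F" for b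
  proof -
    have "h b \<in> fst ` H" using H(5) b by blast
    then obtain g where "g \<in> H" "h b = fst g" by blast
    then have "(h b, snd g) \<in> H" by simp
    then show ?thesis using \<delta>_eq[of b "snd g"] by simp
  qed
  have "partial_derivation R M D h F \<delta>"
    unfolding partial_derivation_def
  proof (intro conjI ballI impI)
    show "\<delta> x \<in> carrier D" if "x \<in> F" for x using \<delta>[OF that] Hs'(1) by auto
  next
    fix x y assume x: "x \<in> F" and y: "y \<in> F"
    then have c: "x \<in> carrier M" "y \<in> carrier M" using F(2) by auto
    show "\<delta> (x \<oplus>\<^bsub>M\<^esub> y) = \<delta> x \<oplus>\<^bsub>D\<^esub> \<delta> y"
      using Hs'(7)[OF \<delta>[OF x] \<delta>[OF y]] c by (intro \<delta>_eq) simp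
    show "\<delta> (x \<otimes>\<^bsub>M\<^esub> y) = h x \<otimes>\<^bsub>D\<^esub> \<delta> y \<oplus>\<^bsub>D\<^esub> h y \<otimes>\<^bsub>D\<^esub> \<delta> x"
      using Hs'(6)[OF \<delta>[OF x] \<delta>[OF y]] c by (intro \<delta>_eq) simp
  next
    fix c assume "c \<in> carrier R"
    then have "h (c \<odot>\<^bsub>M\<^esub> \<one>\<^bsub>M\<^esub>) \<in> h ` K" by (simp add: K_def)
    then show "\<delta> (c \<odot>\<^bsub>M\<^esub> \<one>\<^bsub>M\<^esub>) = \<zero>\<^bsub>D\<^esub>" using H(2) by (intro \<delta>_eq) auto
  qed
  then have "\<delta> a = \<zero>\<^bsub>D\<^esub>" using vanish[OF F(1) _ F(2)] by (auto simp: F_def)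
  then show False using \<delta>_eq[OF H(3)] H(4) by simp
qed

section \<open>Reduced integral algebras have no differentials\<close>

context cring
begin

text \<open>Powers of q are split off, and counted by \<open>j\<close>, until the lowest coefficient
  is nonzero. That coefficient is then a unit, and the relation can be divided by it.\<close>

lemma power_annihilated_if_relation:
  assumes K: "subring K R" and inv: "\<And>c. c \<in> K \<Longrightarrow> c \<noteq> \<zero> \<Longrightarrow> \<exists>d\<in>K. c \<otimes> d = \<one>"
    and q: "q \<in> carrier R" and p: "p \<noteq> []" "set p \<subseteq> K" "last p = \<one>"
    and zero: "q [^] (j :: nat) \<otimes> peval R p q = \<zero>"
  shows "\<exists>m r. r \<in> carrier R \<and> q [^] (m :: nat) \<otimes> (\<one> \<ominus> q \<otimes> r) = \<zero>"
  using p zero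
proof (induction p arbitrary: j)
  case (Cons c p)
  note Ks = subringE[OF K]
  have qj: "q [^] j \<in> carrier R" using q by simp
  have pc: "set p \<subseteq> carrier R" "c \<in> K" "c \<in> carrier R" using Cons(3) Ks(1) by auto
  have e: "peval R p q \<in> carrier R" using pc(1) q by simp
  show ?case
  proof (cases "c = \<zero>")
    case True
    show ?thesis
    proof (cases "p = []")
      \<comment> \<open>This happens in the zero ring only: the list is [0], yet its last entry is
        one.\<close>
      case True
      with \<open>c = \<zero>\<close> Cons(4) have "\<one> = \<zero>" by simp
      then have "q [^] j \<otimes> (\<one> \<ominus> q \<otimes> \<zero>) = \<zero>" using one_zeroD qj q by auto
      then show ?thesis by blast
    next
      case False
      have "q [^] Suc j \<otimes> peval R p q = q [^] j \<otimes> peval R (c # p) q"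
        using True q e by (simp add: m_assoc)
      then have "q [^] Suc j \<otimes> peval R p q = \<zero>" using Cons(5) by simp
      then show ?thesis using Cons.IH[of "Suc j"] False Cons(3,4) by simp
    qed
  next
    case False
    then obtain d where d: "d \<in> K" "c \<otimes> d = \<one>" using inv pc(2) by blast
    have dc: "d \<in> carrier R" using d(1) Ks(1) by blast
    \<comment> \<open>The choice r = - d p(q) turns 1 - q r into d (c + q p(q)), which is d times
      the value of the whole list.\<close>
    have "q [^] j \<otimes> (\<one> \<ominus> q \<otimes> (\<ominus> (d \<otimes> peval R p q)))
        = q [^] j \<otimes> (c \<otimes> d \<ominus> q \<otimes> (\<ominus> (d \<otimes> peval R p q)))" by (simp only: d(2))
    also have "\<dots> = d \<otimes> (q [^] j \<otimes> peval R (c # p) q)"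
      using q qj e dc pc(3) by (simp, algebra)
    also have "\<dots> = \<zero>" using Cons(5) dc by simp
    finally show ?thesis using dc e by (intro exI[of _ j] exI[of _ "\<ominus> (d \<otimes> peval R p q)"]) simp
  qed
qed auto

text \<open>This is von Neumann regularity. With u = 1 - q r, the equation q^m u = 0 makes q u
  nilpotent, hence zero because the ring is reduced.\<close>

lemma regular_if_integral:
  assumes red: "reduced R" and K: "char_zero_field_image R K"
    and q: "q \<in> carrier R" and int: "integral_over R K q"
  shows "\<exists>r\<in>carrier R. q \<otimes> q \<otimes> r = q"
proof -
  obtain p where p: "p \<noteq> []" "set p \<subseteq> K" "last p = \<one>" "peval R p q = \<zero>"
    using int by (auto simp: integral_over_def)
  then obtain m r where r: "r \<in> carrier R" "q [^] (m :: nat) \<otimes> (\<one> \<ominus> q \<otimes> r) = \<zero>"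
    using power_annihilated_if_relation[OF _ _ q p(1-3), of 0] K q
    unfolding char_zero_field_image_def by auto
  define u where "u = \<one> \<ominus> q \<otimes> r"
  have u: "u \<in> carrier R" using q r by (simp add: u_def)
  have c: "q [^] m \<in> carrier R" "u [^] m \<in> carrier R" using q u by auto
  have "(q \<otimes> u) [^] Suc m = (q [^] m \<otimes> u) \<otimes> (u [^] m \<otimes> q)"
    using q u c by (simp add: nat_pow_distrib m_ac)
  also have "\<dots> = \<zero>" using r(2) q c by (simp add: u_def)
  finally have "q \<otimes> u = \<zero>" using red q u unfolding reduced_def by (metis m_closed)
  moreover have "q = q \<otimes> q \<otimes> r \<oplus> q \<otimes> u"
    using q r(1) unfolding u_def by algebra
  ultimately show ?thesis using q r(1) by (intro bexI[of _ r]) auto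
qed

end

text \<open>Stated pointwise, so that identities in the free module become identities in the ring.\<close>

context algebra
begin

lemma kaehler_submodule_rules:
  defines "N \<equiv> kaehler_submodule R M" and "d \<equiv> basis_elt M"
  shows kaehler_add: "f \<in> N \<Longrightarrow> g \<in> N \<Longrightarrow> (\<lambda>z. f z \<oplus>\<^bsub>M\<^esub> g z) \<in> N"
    and kaehler_smult: "a \<in> carrier M \<Longrightarrow> f \<in> N \<Longrightarrow> (\<lambda>z. a \<otimes>\<^bsub>M\<^esub> f z) \<in> N"
    and kaehler_minus: "f \<in> N \<Longrightarrow> g \<in> N \<Longrightarrow> (\<lambda>z. f z \<ominus>\<^bsub>M\<^esub> g z) \<in> N"
    and kaehler_d_add: "x \<in> carrier M \<Longrightarrow> y \<in> carrier M \<Longrightarrow>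
      (\<lambda>z. d (x \<oplus>\<^bsub>M\<^esub> y) z \<ominus>\<^bsub>M\<^esub> (d x z \<oplus>\<^bsub>M\<^esub> d y z)) \<in> N"
    and kaehler_d_mult: "x \<in> carrier M \<Longrightarrow> y \<in> carrier M \<Longrightarrow>
      (\<lambda>z. d (x \<otimes>\<^bsub>M\<^esub> y) z \<ominus>\<^bsub>M\<^esub> (x \<otimes>\<^bsub>M\<^esub> d y z \<oplus>\<^bsub>M\<^esub> y \<otimes>\<^bsub>M\<^esub> d x z)) \<in> N"
    and kaehler_d_scalar: "c \<in> carrier R \<Longrightarrow> d (c \<odot>\<^bsub>M\<^esub> \<one>\<^bsub>M\<^esub>) \<in> N"
proof -
  let ?F = "free_module M (carrier M)"
  interpret F: module M ?F by (rule cring.free_module_is_module[OF M_cring])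
  note sub = kaehler_submodule_submodule[folded N_def]
  note N = F.submoduleE[OF sub]
  note minus = cring.free_module_minus[OF M_cring, of _ "carrier M"]
  have d: "d x \<in> carrier ?F" if "x \<in> carrier M" for x
    unfolding d_def using that by (rule cring.basis_elt_closed[OF M_cring])
  show add: "(\<lambda>z. f z \<oplus>\<^bsub>M\<^esub> g z) \<in> N" if "f \<in> N" "g \<in> N" for f g using N(5)[OF that] by simp
  show "(\<lambda>z. a \<otimes>\<^bsub>M\<^esub> f z) \<in> N" if "a \<in> carrier M" "f \<in> N" for a f using N(4)[OF that] by simp
  show "(\<lambda>z. f z \<ominus>\<^bsub>M\<^esub> g z) \<in> N" if "f \<in> N" "g \<in> N" for f g
  proof -
    have "f \<ominus>\<^bsub>?F\<^esub> g \<in> N" unfolding a_minus_def using N(5)[OF that(1) N(3)[OF that(2)]] .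
    then show ?thesis using minus[of f g] subsetD[OF N(1) that(1)] subsetD[OF N(1) that(2)] by simp
  qed
  note rel = kaehler_relations_subset[folded N_def, unfolded kaehler_relations_def Let_def, folded d_def]
  show "(\<lambda>z. d (x \<oplus>\<^bsub>M\<^esub> y) z \<ominus>\<^bsub>M\<^esub> (d x z \<oplus>\<^bsub>M\<^esub> d y z)) \<in> N" if x: "x \<in> carrier M" and y: "y \<in> carrier M" for x y
  proof -
    have "d (x \<oplus>\<^bsub>M\<^esub> y) \<ominus>\<^bsub>?F\<^esub> (d x \<oplus>\<^bsub>?F\<^esub> d y) \<in> N" by (rule subsetD[OF rel]) (use x y in blast)
    then show ?thesis using minus[OF d F.M.a_closed[OF d[OF x] d[OF y]], of "x \<oplus>\<^bsub>M\<^esub> y"] x y by simp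
  qed
  show "(\<lambda>z. d (x \<otimes>\<^bsub>M\<^esub> y) z \<ominus>\<^bsub>M\<^esub> (x \<otimes>\<^bsub>M\<^esub> d y z \<oplus>\<^bsub>M\<^esub> y \<otimes>\<^bsub>M\<^esub> d x z)) \<in> N" if x: "x \<in> carrier M" and y: "y \<in> carrier M" for x y
  proof -
    have "d (x \<otimes>\<^bsub>M\<^esub> y) \<ominus>\<^bsub>?F\<^esub> (x \<odot>\<^bsub>?F\<^esub> d y \<oplus>\<^bsub>?F\<^esub> y \<odot>\<^bsub>?F\<^esub> d x) \<in> N" by (rule subsetD[OF rel]) (use x y in blast)
    then show ?thesis
      using minus[OF d F.M.a_closed[OF F.smult_closed[OF x d[OF y]] F.smult_closed[OF y d[OF x]]], of "x \<otimes>\<^bsub>M\<^esub> y"] x y by simp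
  qed
  show "d (c \<odot>\<^bsub>M\<^esub> \<one>\<^bsub>M\<^esub>) \<in> N" if "c \<in> carrier R" for c by (rule subsetD[OF rel]) (use that in blast)
qed

text \<open>The pairs with d x = x' d b in Omega. Starting from (c, 0) for scalars c and from (b,
  1), evaluation in this subring yields (f(b), f'(b)), which is the chain rule d f(b) = f'(b) d
  b.\<close>

lemma kaehler_pairs_subring:
  assumes b: "b \<in> carrier M"
  shows "subring {(x, x'). x \<in> carrier M \<and> x' \<in> carrier M \<and>
    (\<lambda>z. basis_elt M x z \<ominus>\<^bsub>M\<^esub> x' \<otimes>\<^bsub>M\<^esub> basis_elt M b z) \<in> kaehler_submodule R M} (dual M)"
    (is "subring ?T _")
proof -
  interpret D: cring "dual M" by (rule cring.dual_cring[OF M_cring])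
  let ?N = "kaehler_submodule R M"
  let ?d = "basis_elt M"
  have d: "?d x z \<in> carrier M" for x z by (simp add: basis_elt_def)
  have scalar: "(c \<odot>\<^bsub>M\<^esub> \<one>\<^bsub>M\<^esub>, \<zero>\<^bsub>M\<^esub>) \<in> ?T" if c: "c \<in> carrier R" for c
  proof -
    have "(\<lambda>z. ?d (c \<odot>\<^bsub>M\<^esub> \<one>\<^bsub>M\<^esub>) z \<ominus>\<^bsub>M\<^esub> \<zero>\<^bsub>M\<^esub> \<otimes>\<^bsub>M\<^esub> ?d b z) = ?d (c \<odot>\<^bsub>M\<^esub> \<one>\<^bsub>M\<^esub>)"
    proof
      fix z
      have "D \<ominus>\<^bsub>M\<^esub> \<zero>\<^bsub>M\<^esub> \<otimes>\<^bsub>M\<^esub> B = D" if "D \<in> carrier M" "B \<in> carrier M" for D B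
        using that by algebra
      from this[OF d d] show "?d (c \<odot>\<^bsub>M\<^esub> \<one>\<^bsub>M\<^esub>) z \<ominus>\<^bsub>M\<^esub> \<zero>\<^bsub>M\<^esub> \<otimes>\<^bsub>M\<^esub> ?d b z = ?d (c \<odot>\<^bsub>M\<^esub> \<one>\<^bsub>M\<^esub>) z" .
    qed
    then show ?thesis using kaehler_d_scalar[OF c] c by auto
  qed
  have mult: "u \<otimes>\<^bsub>dual M\<^esub> v \<in> ?T" if u: "u \<in> ?T" and v: "v \<in> ?T" for u v
  proof -
    obtain x x' y y' where uv: "u = (x, x')" "v = (y, y')" by (cases u, cases v)
    have c: "x \<in> carrier M" "x' \<in> carrier M" "y \<in> carrier M" "y' \<in> carrier M" using u v uv by auto
    have x: "(\<lambda>z. ?d x z \<ominus>\<^bsub>M\<^esub> x' \<otimes>\<^bsub>M\<^esub> ?d b z) \<in> ?N" and y: "(\<lambda>z. ?d y z \<ominus>\<^bsub>M\<^esub> y' \<otimes>\<^bsub>M\<^esub> ?d b z) \<in> ?N"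
      using u v uv by auto
    \<comment> \<open>The Leibniz relation for x y, plus x times the membership of y, plus y times
      that of x; \<open>eq\<close> is the resulting identity for one coordinate, with ring elements
      in place of the symbols.\<close>
    note n = kaehler_add[OF kaehler_d_mult[OF c(1,3)] kaehler_add[OF kaehler_smult[OF c(1) y] kaehler_smult[OF c(3) x]]]
    have eq: "D \<ominus>\<^bsub>M\<^esub> (x \<otimes>\<^bsub>M\<^esub> y' \<oplus>\<^bsub>M\<^esub> y \<otimes>\<^bsub>M\<^esub> x') \<otimes>\<^bsub>M\<^esub> B =
      D \<ominus>\<^bsub>M\<^esub> (x \<otimes>\<^bsub>M\<^esub> Y \<oplus>\<^bsub>M\<^esub> y \<otimes>\<^bsub>M\<^esub> X) \<oplus>\<^bsub>M\<^esub> (x \<otimes>\<^bsub>M\<^esub> (Y \<ominus>\<^bsub>M\<^esub> y' \<otimes>\<^bsub>M\<^esub> B) \<oplus>\<^bsub>M\<^esub> y \<otimes>\<^bsub>M\<^esub> (X \<ominus>\<^bsub>M\<^esub> x' \<otimes>\<^bsub>M\<^esub> B))"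
      if "D \<in> carrier M" "B \<in> carrier M" "X \<in> carrier M" "Y \<in> carrier M" for D B X Y
      using that c by algebra
    have "(\<lambda>z. ?d (x \<otimes>\<^bsub>M\<^esub> y) z \<ominus>\<^bsub>M\<^esub> (x \<otimes>\<^bsub>M\<^esub> y' \<oplus>\<^bsub>M\<^esub> y \<otimes>\<^bsub>M\<^esub> x') \<otimes>\<^bsub>M\<^esub> ?d b z) \<in> ?N"
      by (rule back_subst[where P = "\<lambda>f. f \<in> ?N", OF n]) (rule ext, rule eq[OF d d d d, symmetric])
    then show ?thesis using c by (simp add: uv)
  qed
  have add: "u \<oplus>\<^bsub>dual M\<^esub> v \<in> ?T" if u: "u \<in> ?T" and v: "v \<in> ?T" for u v
  proof -
    obtain x x' y y' where uv: "u = (x, x')" "v = (y, y')" by (cases u, cases v)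
    have c: "x \<in> carrier M" "x' \<in> carrier M" "y \<in> carrier M" "y' \<in> carrier M" using u v uv by auto
    have x: "(\<lambda>z. ?d x z \<ominus>\<^bsub>M\<^esub> x' \<otimes>\<^bsub>M\<^esub> ?d b z) \<in> ?N" and y: "(\<lambda>z. ?d y z \<ominus>\<^bsub>M\<^esub> y' \<otimes>\<^bsub>M\<^esub> ?d b z) \<in> ?N"
      using u v uv by auto
    note n = kaehler_add[OF kaehler_d_add[OF c(1,3)] kaehler_add[OF x y]]
    have eq: "D \<ominus>\<^bsub>M\<^esub> (x' \<oplus>\<^bsub>M\<^esub> y') \<otimes>\<^bsub>M\<^esub> B =
      D \<ominus>\<^bsub>M\<^esub> (X \<oplus>\<^bsub>M\<^esub> Y) \<oplus>\<^bsub>M\<^esub> (X \<ominus>\<^bsub>M\<^esub> x' \<otimes>\<^bsub>M\<^esub> B \<oplus>\<^bsub>M\<^esub> (Y \<ominus>\<^bsub>M\<^esub> y' \<otimes>\<^bsub>M\<^esub> B))"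
      if "D \<in> carrier M" "B \<in> carrier M" "X \<in> carrier M" "Y \<in> carrier M" for D B X Y
      using that c by algebra
    have "(\<lambda>z. ?d (x \<oplus>\<^bsub>M\<^esub> y) z \<ominus>\<^bsub>M\<^esub> (x' \<oplus>\<^bsub>M\<^esub> y') \<otimes>\<^bsub>M\<^esub> ?d b z) \<in> ?N"
      by (rule back_subst[where P = "\<lambda>f. f \<in> ?N", OF n]) (rule ext, rule eq[OF d d d d, symmetric])
    then show ?thesis using c by (simp add: uv)
  qed
  show ?thesis
  proof (rule D.subringI)
    show "?T \<subseteq> carrier (dual M)" by auto
    show "\<one>\<^bsub>dual M\<^esub> \<in> ?T" using scalar[OF R.one_closed] by simp
  next
    fix u assume u: "u \<in> ?T"
    \<comment> \<open>Negation is multiplication by (-1, 0), a pair coming from a scalar.\<close>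
    have neg: "((\<ominus> \<one>) \<odot>\<^bsub>M\<^esub> \<one>\<^bsub>M\<^esub>, \<zero>\<^bsub>M\<^esub>) = (\<ominus>\<^bsub>M\<^esub> \<one>\<^bsub>M\<^esub>, \<zero>\<^bsub>M\<^esub>)"
      by (simp add: smult_l_minus)
    have "(\<ominus>\<^bsub>M\<^esub> \<one>\<^bsub>M\<^esub>, \<zero>\<^bsub>M\<^esub>) \<otimes>\<^bsub>dual M\<^esub> u = \<ominus>\<^bsub>dual M\<^esub> u"
    proof (cases u)
      case (Pair x x')
      then have c: "x \<in> carrier M" "x' \<in> carrier M" using u by auto
      have "\<ominus>\<^bsub>M\<^esub> \<one>\<^bsub>M\<^esub> \<otimes>\<^bsub>M\<^esub> x = \<ominus>\<^bsub>M\<^esub> x" "\<ominus>\<^bsub>M\<^esub> \<one>\<^bsub>M\<^esub> \<otimes>\<^bsub>M\<^esub> x' \<oplus>\<^bsub>M\<^esub> x \<otimes>\<^bsub>M\<^esub> \<zero>\<^bsub>M\<^esub> = \<ominus>\<^bsub>M\<^esub> x'"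
        using c by algebra+
      then show ?thesis using Pair c cring.dual_uminus[OF M_cring] by simp
    qed
    then show "\<ominus>\<^bsub>dual M\<^esub> u \<in> ?T"
      using mult[OF scalar[of "\<ominus> \<one>"] u] unfolding neg by simp
  qed (rule mult add; assumption)+
qed

text \<open>
  Rather than splitting into residue fields, the induction on the degree of a relation \<open>w f(b) = 0\<close>
  with \<open>w\<close> idempotent splits off the idempotent \<open>e\<close> generating the same ideal as \<open>f'(b)\<close>:
  \<open>f'(b) db = 0\<close> kills \<open>e db\<close>, and on \<open>1 - e\<close> the derivative is a relation of smaller degree.
\<close>

lemma idempotent_smult_d_in_kaehler:
  assumes red: "reduced M" and K: "K = (\<lambda>c. c \<odot>\<^bsub>M\<^esub> \<one>\<^bsub>M\<^esub>) ` carrier R"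
    and char0: "char_zero_field_image M K"
    and int: "\<And>x. x \<in> carrier M \<Longrightarrow> integral_over M K x" and b: "b \<in> carrier M"
    and w: "w \<in> carrier M" "w \<otimes>\<^bsub>M\<^esub> w = w"
    and f: "f \<noteq> []" "set f \<subseteq> K" "\<exists>u\<in>K. last f \<otimes>\<^bsub>M\<^esub> u = \<one>\<^bsub>M\<^esub>"
    and zero: "w \<otimes>\<^bsub>M\<^esub> peval M f b = \<zero>\<^bsub>M\<^esub>"
  shows "(\<lambda>z. w \<otimes>\<^bsub>M\<^esub> basis_elt M b z) \<in> kaehler_submodule R M"
  using w f zero
proof (induction "length f" arbitrary: f w)
  case (Suc n)
  let ?N = "kaehler_submodule R M"
  let ?d = "basis_elt M"
  have KM: "subring K M" and Knat: "\<And>n::nat. n > 0 \<Longrightarrow> \<exists>d\<in>K. ([n] \<cdot>\<^bsub>M\<^esub> \<one>\<^bsub>M\<^esub>) \<otimes>\<^bsub>M\<^esub> d = \<one>\<^bsub>M\<^esub>"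
    using char0 by (auto simp: char_zero_field_image_def)
  note Ks = subringE[OF KM]
  have d: "?d x z \<in> carrier M" for x z by (simp add: basis_elt_def)
  note w = Suc(3,4)
  have fM: "set f \<subseteq> carrier M" using Suc(6) Ks(1) by blast
  obtain u where u: "u \<in> K" "last f \<otimes>\<^bsub>M\<^esub> u = \<one>\<^bsub>M\<^esub>" using Suc(7) by blast
  have uM: "u \<in> carrier M" using u(1) Ks(1) by blast
  have lM: "last f \<in> carrier M" using fM Suc(5) by auto
  define v where "v = peval M f b"
  have v: "v \<in> carrier M" unfolding v_def by (rule cring.peval_closed[OF M_cring fM b])
  have wv: "w \<otimes>\<^bsub>M\<^esub> v = \<zero>\<^bsub>M\<^esub>" using Suc(8) by (simp add: v_def)
  \<comment> \<open>Multiplied by zero, this puts the zero function into \<open>?N\<close>.\<close>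
  have one_N: "?d \<one>\<^bsub>M\<^esub> \<in> ?N" using kaehler_d_scalar[OF R.one_closed] by simp
  show ?case
  proof (cases "n = 0")
    case True
    then obtain c where c: "f = [c]" using Suc(2) by (cases f) auto
    then have "v = c" "c \<in> carrier M" using fM b unfolding v_def by auto
    \<comment> \<open>A relation of degree zero is a unit, so \<open>w\<close> itself
      vanishes.\<close>
    then have "w = \<zero>\<^bsub>M\<^esub>"
    proof -
      have "w = w \<otimes>\<^bsub>M\<^esub> (c \<otimes>\<^bsub>M\<^esub> u)" using u(2) c w(1) by simp
      also have "\<dots> = (w \<otimes>\<^bsub>M\<^esub> c) \<otimes>\<^bsub>M\<^esub> u" using w(1) uM \<open>c \<in> carrier M\<close> by algebra
      finally have "w = (w \<otimes>\<^bsub>M\<^esub> c) \<otimes>\<^bsub>M\<^esub> u" .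
      then show ?thesis using wv \<open>v = c\<close> uM by simp
    qed
    have "(\<lambda>z. \<zero>\<^bsub>M\<^esub> \<otimes>\<^bsub>M\<^esub> ?d \<one>\<^bsub>M\<^esub> z) \<in> ?N"
      using kaehler_smult[OF _ one_N, of "\<zero>\<^bsub>M\<^esub>"] by simp
    moreover have id1: "\<zero>\<^bsub>M\<^esub> \<otimes>\<^bsub>M\<^esub> D = \<zero>\<^bsub>M\<^esub> \<otimes>\<^bsub>M\<^esub> B" if "D \<in> carrier M" "B \<in> carrier M" for D B
      using that by algebra
    have "(\<lambda>z. \<zero>\<^bsub>M\<^esub> \<otimes>\<^bsub>M\<^esub> ?d \<one>\<^bsub>M\<^esub> z) = (\<lambda>z. \<zero>\<^bsub>M\<^esub> \<otimes>\<^bsub>M\<^esub> ?d b z)" by (rule ext, rule id1[OF d d])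
    ultimately show ?thesis using \<open>w = \<zero>\<^bsub>M\<^esub>\<close> by simp
  next
    case False
    then have len: "length f \<ge> 2" using Suc(2) by simp
    define g where "g = pderiv M f"
    have gK: "set g \<subseteq> K" unfolding g_def by (rule cring.set_pderiv_subring[OF M_cring KM Suc(6)])
    have gM: "set g \<subseteq> carrier M" using gK Ks(1) by blast
    have glen: "n = length g" using Suc(2) by (simp add: g_def)
    have gne: "g \<noteq> []" using glen False by auto
    define q where "q = peval M g b"
    have q: "q \<in> carrier M" unfolding q_def by (rule cring.peval_closed[OF M_cring gM b])
    obtain r where r: "r \<in> carrier M" "q \<otimes>\<^bsub>M\<^esub> q \<otimes>\<^bsub>M\<^esub> r = q"
      using cring.regular_if_integral[OF M_cring red char0 q int[OF q]] by blast
    \<comment> \<open>From q q r = q it follows that q r is idempotent and q e = q, so e and q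
      generate the same ideal.\<close>
    define e where "e = q \<otimes>\<^bsub>M\<^esub> r"
    have e: "e \<in> carrier M" using q r by (simp add: e_def)
    have ee: "e \<otimes>\<^bsub>M\<^esub> e = e"
    proof -
      have "e \<otimes>\<^bsub>M\<^esub> e = (q \<otimes>\<^bsub>M\<^esub> q \<otimes>\<^bsub>M\<^esub> r) \<otimes>\<^bsub>M\<^esub> r" unfolding e_def using q r(1) by algebra
      then show ?thesis unfolding r(2) e_def .
    qed
    \<comment> \<open>The chain rule d f(b) = f'(b) d b, read off from an evaluation at (b, 1) in
      the dual numbers.\<close>
    have pair: "(\<lambda>z. ?d v z \<ominus>\<^bsub>M\<^esub> q \<otimes>\<^bsub>M\<^esub> ?d b z) \<in> ?N"
    proof -
      let ?T = "{(x, x'). x \<in> carrier M \<and> x' \<in> carrier M \<and> (\<lambda>z. ?d x z \<ominus>\<^bsub>M\<^esub> x' \<otimes>\<^bsub>M\<^esub> ?d b z) \<in> ?N}"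
      let ?P = "map (\<lambda>c. (c, \<zero>\<^bsub>M\<^esub>)) f"
      have "(c, \<zero>\<^bsub>M\<^esub>) \<in> ?T" if c: "c \<in> set f" for c
      proof -
        have "c \<in> K" using c Suc(6) by blast
        then have c: "?d c \<in> ?N" "c \<in> carrier M" using kaehler_d_scalar Ks(1) by (auto simp: K)
        have id0: "D \<ominus>\<^bsub>M\<^esub> \<zero>\<^bsub>M\<^esub> \<otimes>\<^bsub>M\<^esub> B = D" if "D \<in> carrier M" "B \<in> carrier M" for D B
          using that by algebra
        have "(\<lambda>z. ?d c z \<ominus>\<^bsub>M\<^esub> \<zero>\<^bsub>M\<^esub> \<otimes>\<^bsub>M\<^esub> ?d b z) = ?d c" by (rule ext, rule id0[OF d d])
        then show ?thesis using c by simp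
      qed
      then have PT: "set ?P \<subseteq> ?T" by auto
      have bT: "(b, \<one>\<^bsub>M\<^esub>) \<in> ?T"
      proof -
        have id2: "D \<ominus>\<^bsub>M\<^esub> \<one>\<^bsub>M\<^esub> \<otimes>\<^bsub>M\<^esub> D = \<zero>\<^bsub>M\<^esub> \<otimes>\<^bsub>M\<^esub> B" if "D \<in> carrier M" "B \<in> carrier M" for D B
        proof -
          have "D \<ominus>\<^bsub>M\<^esub> D = \<zero>\<^bsub>M\<^esub> \<otimes>\<^bsub>M\<^esub> B" using that by algebra
          moreover have "\<one>\<^bsub>M\<^esub> \<otimes>\<^bsub>M\<^esub> D = D" using that by simp
          ultimately show ?thesis by simp
        qed
        have "(\<lambda>z. ?d b z \<ominus>\<^bsub>M\<^esub> \<one>\<^bsub>M\<^esub> \<otimes>\<^bsub>M\<^esub> ?d b z) = (\<lambda>z. \<zero>\<^bsub>M\<^esub> \<otimes>\<^bsub>M\<^esub> ?d \<one>\<^bsub>M\<^esub> z)" by (rule ext, rule id2[OF d d])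
        then show ?thesis using kaehler_smult[OF _ one_N, of "\<zero>\<^bsub>M\<^esub>"] b by simp
      qed
      have "peval (dual M) ?P (b, \<one>\<^bsub>M\<^esub>) \<in> ?T"
        by (rule cring.peval_in_subring[OF cring.dual_cring[OF M_cring] kaehler_pairs_subring[OF b] PT bT])
      moreover have "peval (dual M) ?P (b, \<one>\<^bsub>M\<^esub>) = (v, q)"
      proof -
        have P: "set ?P \<subseteq> carrier M \<times> carrier M" "map fst ?P = f" "map snd ?P = map (\<lambda>_. \<zero>\<^bsub>M\<^esub>) f"
          using fM by (auto simp: comp_def)
        have "peval M (map (\<lambda>_. \<zero>\<^bsub>M\<^esub>) f) b = \<zero>\<^bsub>M\<^esub>"
          by (rule cring.peval_zeros[OF M_cring _ b]) auto
        then show ?thesis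
          using cring.peval_dual[OF M_cring P(1) b cring.cring_simprules(6)[OF M_cring]] q
          unfolding P(2,3) by (simp add: v_def q_def g_def)
      qed
      ultimately show ?thesis by simp
    qed
    \<comment> \<open>From w v = 0 comes w d v + v d w = 0. Multiplying by the idempotent w kills
      the second term and leaves the first unchanged.\<close>
    have wdv: "(\<lambda>z. w \<otimes>\<^bsub>M\<^esub> ?d v z) \<in> ?N"
    proof -
      have d0: "?d \<zero>\<^bsub>M\<^esub> \<in> ?N" using kaehler_d_scalar[OF R.zero_closed] by simp
      note n = kaehler_minus[OF kaehler_smult[OF w(1) d0] kaehler_smult[OF w(1) kaehler_d_mult[OF w(1) v]]]
      have id3: "w \<otimes>\<^bsub>M\<^esub> Z \<ominus>\<^bsub>M\<^esub> w \<otimes>\<^bsub>M\<^esub> (Z \<ominus>\<^bsub>M\<^esub> (w \<otimes>\<^bsub>M\<^esub> V \<oplus>\<^bsub>M\<^esub> v \<otimes>\<^bsub>M\<^esub> W)) = w \<otimes>\<^bsub>M\<^esub> V"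
        if "Z \<in> carrier M" "V \<in> carrier M" "W \<in> carrier M" for Z V W
      proof -
        have "w \<otimes>\<^bsub>M\<^esub> Z \<ominus>\<^bsub>M\<^esub> w \<otimes>\<^bsub>M\<^esub> (Z \<ominus>\<^bsub>M\<^esub> (w \<otimes>\<^bsub>M\<^esub> V \<oplus>\<^bsub>M\<^esub> v \<otimes>\<^bsub>M\<^esub> W)) =
            (w \<otimes>\<^bsub>M\<^esub> w) \<otimes>\<^bsub>M\<^esub> V \<oplus>\<^bsub>M\<^esub> (w \<otimes>\<^bsub>M\<^esub> v) \<otimes>\<^bsub>M\<^esub> W"
          using that w(1) v by algebra
        also have "\<dots> = w \<otimes>\<^bsub>M\<^esub> V" unfolding w(2) wv using that w(1) by algebra
        finally show ?thesis .
      qed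
      have eq: "w \<otimes>\<^bsub>M\<^esub> ?d \<zero>\<^bsub>M\<^esub> z \<ominus>\<^bsub>M\<^esub> w \<otimes>\<^bsub>M\<^esub> (?d \<zero>\<^bsub>M\<^esub> z \<ominus>\<^bsub>M\<^esub> (w \<otimes>\<^bsub>M\<^esub> ?d v z \<oplus>\<^bsub>M\<^esub> v \<otimes>\<^bsub>M\<^esub> ?d w z)) = w \<otimes>\<^bsub>M\<^esub> ?d v z" for z
        by (rule id3[OF d d d])
      show ?thesis using n unfolding wv eq .
    qed
    \<comment> \<open>Here w q d b = w d v = 0, and multiplication by r turns q into e.\<close>
    have we: "(\<lambda>z. (w \<otimes>\<^bsub>M\<^esub> e) \<otimes>\<^bsub>M\<^esub> ?d b z) \<in> ?N"
    proof -
      note n = kaehler_smult[OF r(1) kaehler_minus[OF wdv kaehler_smult[OF w(1) pair]]]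
      have id4: "r \<otimes>\<^bsub>M\<^esub> (w \<otimes>\<^bsub>M\<^esub> V \<ominus>\<^bsub>M\<^esub> w \<otimes>\<^bsub>M\<^esub> (V \<ominus>\<^bsub>M\<^esub> q \<otimes>\<^bsub>M\<^esub> B)) = (w \<otimes>\<^bsub>M\<^esub> e) \<otimes>\<^bsub>M\<^esub> B"
        if "V \<in> carrier M" "B \<in> carrier M" for V B
        unfolding e_def using that w(1) q r(1) by algebra
      have eq: "r \<otimes>\<^bsub>M\<^esub> (w \<otimes>\<^bsub>M\<^esub> ?d v z \<ominus>\<^bsub>M\<^esub> w \<otimes>\<^bsub>M\<^esub> (?d v z \<ominus>\<^bsub>M\<^esub> q \<otimes>\<^bsub>M\<^esub> ?d b z)) = (w \<otimes>\<^bsub>M\<^esub> e) \<otimes>\<^bsub>M\<^esub> ?d b z" for z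
        by (rule id4[OF d d])
      show ?thesis using n unfolding eq .
    qed
    \<comment> \<open>On this idempotent q = f'(b) vanishes, since q (1 - e) = q - q q r =
      0.\<close>
    let ?w = "w \<otimes>\<^bsub>M\<^esub> (\<one>\<^bsub>M\<^esub> \<ominus>\<^bsub>M\<^esub> e)"
    have "(\<lambda>z. ?w \<otimes>\<^bsub>M\<^esub> ?d b z) \<in> ?N"
    proof (rule Suc(1)[OF glen])
      show "?w \<in> carrier M" using w(1) e by simp
      have "?w \<otimes>\<^bsub>M\<^esub> ?w = (w \<otimes>\<^bsub>M\<^esub> w) \<otimes>\<^bsub>M\<^esub> (\<one>\<^bsub>M\<^esub> \<ominus>\<^bsub>M\<^esub> e \<ominus>\<^bsub>M\<^esub> e \<oplus>\<^bsub>M\<^esub> e \<otimes>\<^bsub>M\<^esub> e)"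
        using w(1) e by algebra
      also have "\<dots> = ?w" unfolding w(2) ee using w(1) e by algebra
      finally show "?w \<otimes>\<^bsub>M\<^esub> ?w = ?w" .
      show "g \<noteq> []" by (rule gne)
      show "set g \<subseteq> K" by (rule gK)
      have "?w \<otimes>\<^bsub>M\<^esub> q = w \<otimes>\<^bsub>M\<^esub> (q \<ominus>\<^bsub>M\<^esub> q \<otimes>\<^bsub>M\<^esub> q \<otimes>\<^bsub>M\<^esub> r)"
        unfolding e_def using w(1) q r(1) by algebra
      also have "\<dots> = \<zero>\<^bsub>M\<^esub>" unfolding r(2) using w(1) q by algebra
      finally show "?w \<otimes>\<^bsub>M\<^esub> peval M g b = \<zero>\<^bsub>M\<^esub>" by (simp add: q_def)
      \<comment> \<open>The degree n is a unit of \<open>K\<close>, so the leading coefficient of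
        the derivative is again a unit of \<open>K\<close>.\<close>
      obtain t where t: "t \<in> K" "([n] \<cdot>\<^bsub>M\<^esub> \<one>\<^bsub>M\<^esub>) \<otimes>\<^bsub>M\<^esub> t = \<one>\<^bsub>M\<^esub>" using Knat[of n] False by blast
      have tM: "t \<in> carrier M" using t(1) Ks(1) by blast
      have nM: "[n] \<cdot>\<^bsub>M\<^esub> \<one>\<^bsub>M\<^esub> \<in> carrier M" by simp
      have lg: "last g = ([n] \<cdot>\<^bsub>M\<^esub> \<one>\<^bsub>M\<^esub>) \<otimes>\<^bsub>M\<^esub> last f"
        using cring.last_pderiv_mult[OF M_cring fM len] unfolding g_def by (simp flip: Suc(2))
      have "last g \<otimes>\<^bsub>M\<^esub> (u \<otimes>\<^bsub>M\<^esub> t) = (([n] \<cdot>\<^bsub>M\<^esub> \<one>\<^bsub>M\<^esub>) \<otimes>\<^bsub>M\<^esub> t) \<otimes>\<^bsub>M\<^esub> (last f \<otimes>\<^bsub>M\<^esub> u)"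
        unfolding lg using nM lM uM tM by algebra
      then have "last g \<otimes>\<^bsub>M\<^esub> (u \<otimes>\<^bsub>M\<^esub> t) = \<one>\<^bsub>M\<^esub>" unfolding t(2) u(2) by simp
      then show "\<exists>u\<in>K. last g \<otimes>\<^bsub>M\<^esub> u = \<one>\<^bsub>M\<^esub>" using Ks(6)[OF u(1) t(1)] by blast
    qed
    note n = kaehler_add[OF this we]
    have id5: "?w \<otimes>\<^bsub>M\<^esub> B \<oplus>\<^bsub>M\<^esub> (w \<otimes>\<^bsub>M\<^esub> e) \<otimes>\<^bsub>M\<^esub> B = w \<otimes>\<^bsub>M\<^esub> B" if "B \<in> carrier M" for B
      using that w(1) e by algebra
    have eq: "?w \<otimes>\<^bsub>M\<^esub> ?d b z \<oplus>\<^bsub>M\<^esub> (w \<otimes>\<^bsub>M\<^esub> e) \<otimes>\<^bsub>M\<^esub> ?d b z = w \<otimes>\<^bsub>M\<^esub> ?d b z" for z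
      by (rule id5[OF d])
    show ?thesis using n unfolding eq .
  qed
qed simp

text \<open>The preceding induction, started with the idempotent one and a monic relation of each
  element.\<close>

lemma zero_kaehler_if_integral:
  assumes "reduced M" and K: "K = (\<lambda>c. c \<odot>\<^bsub>M\<^esub> \<one>\<^bsub>M\<^esub>) ` carrier R"
    and char0: "char_zero_field_image M K"
    and int: "\<And>x. x \<in> carrier M \<Longrightarrow> integral_over M K x"
  shows "zero_module (kaehler_differentials R M)"
proof (rule zero_kaehlerI)
  fix b assume b: "b \<in> carrier M"
  obtain f where f: "f \<noteq> []" "set f \<subseteq> K" "last f = \<one>\<^bsub>M\<^esub>" "peval M f b = \<zero>\<^bsub>M\<^esub>"
    using int[OF b] by (auto simp: integral_over_def)
  have "\<one>\<^bsub>M\<^esub> \<in> K" using char0 subringE(3) by (auto simp: char_zero_field_image_def)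
  then have "(\<lambda>z. \<one>\<^bsub>M\<^esub> \<otimes>\<^bsub>M\<^esub> basis_elt M b z) \<in> kaehler_submodule R M"
    using f by (intro idempotent_smult_d_in_kaehler[OF assms b _ _ f(1,2)]) (auto intro!: bexI[of _ "\<one>\<^bsub>M\<^esub>"])
  moreover have "(\<lambda>z. \<one>\<^bsub>M\<^esub> \<otimes>\<^bsub>M\<^esub> basis_elt M b z) = basis_elt M b"
    by (auto simp: basis_elt_def)
  ultimately show "basis_elt M b \<in> kaehler_submodule R M" by simp
qed

end

section \<open>Subalgebras and their union\<close>

text \<open>A fresh record is built because \<open>A\<close> may carry extension fields, whereas the
  members of a direct system have the plain type \<open>module\<close>.\<close>

definition subalgebra_on :: "('k, 'a, 'n) module_scheme \<Rightarrow> 'a set \<Rightarrow> ('k, 'a) module" where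
  "subalgebra_on A B =
    \<lparr>carrier = B, mult = mult A, one = one A, zero = zero A, add = add A, smult = smult A\<rparr>"

lemma subalgebra_on_simps [simp]:
  "carrier (subalgebra_on A B) = B"
  "mult (subalgebra_on A B) = mult A"
  "one (subalgebra_on A B) = one A"
  "zero (subalgebra_on A B) = zero A"
  "add (subalgebra_on A B) = add A"
  "smult (subalgebra_on A B) = smult A"
  by (simp_all add: subalgebra_on_def)

lemma peval_subalgebra_on: "peval (subalgebra_on A B) p x = peval A p x"
  by (induction p) auto

lemma nat_pow_subalgebra_on: "x [^]\<^bsub>subalgebra_on A B\<^esub> (n :: nat) = x [^]\<^bsub>A\<^esub> n"
  by (simp add: nat_pow_def)

context algebra
begin

abbreviation (input) scalars where "scalars \<equiv> (\<lambda>c. c \<odot>\<^bsub>M\<^esub> \<one>\<^bsub>M\<^esub>) ` carrier R"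

lemma algebra_subalgebra_on:
  assumes B: "subring B M" and sc: "scalars \<subseteq> B"
  shows "algebra R (subalgebra_on M B)"
proof -
  note Bs = subringE[OF B]
  have Bc: "x \<in> carrier M" if "x \<in> B" for x using that Bs(1) by blast
  have "cring (subalgebra_on M B)"
  proof (rule cringI)
    show "abelian_group (subalgebra_on M B)"
    proof (rule abelian_groupI)
      fix x assume x: "x \<in> carrier (subalgebra_on M B)"
      then show "\<exists>y\<in>carrier (subalgebra_on M B). y \<oplus>\<^bsub>subalgebra_on M B\<^esub> x = \<zero>\<^bsub>subalgebra_on M B\<^esub>"
        using Bs(5) Bc by (intro bexI[of _ "\<ominus>\<^bsub>M\<^esub> x"]) (auto simp: M.l_neg)
    qed (use Bs in \<open>auto simp: Bc M.a_ac\<close>)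
    show "comm_monoid (subalgebra_on M B)"
      by (rule comm_monoidI) (use Bs in \<open>auto simp: Bc cring.cring_simprules(11,12)[OF M_cring] intro: cring.cring_simprules(14)[OF M_cring]\<close>)
  qed (auto simp: Bc cring.cring_simprules(13)[OF M_cring])
  then show ?thesis
  proof (rule algebraI[OF R_cring])
    fix c x assume c: "c \<in> carrier R" and x: "x \<in> carrier (subalgebra_on M B)"
    \<comment> \<open>Closure under scalars reduces to closure under products with images of
      scalars.\<close>
    have "(c \<odot>\<^bsub>M\<^esub> \<one>\<^bsub>M\<^esub>) \<otimes>\<^bsub>M\<^esub> x = c \<odot>\<^bsub>M\<^esub> x"
      using smult_assoc2[OF c _ Bc, of "\<one>\<^bsub>M\<^esub>" x] Bc[of x] x by simp
    then show "c \<odot>\<^bsub>subalgebra_on M B\<^esub> x \<in> carrier (subalgebra_on M B)"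
      using Bs(6)[of "c \<odot>\<^bsub>M\<^esub> \<one>\<^bsub>M\<^esub>" x] sc c x by auto
  qed (auto simp: Bc smult_l_distr smult_r_distr smult_assoc1 smult_assoc2)
qed

text \<open>Being of finite type is tested inside the subalgebra, whereas its generators were chosen
  in the ambient algebra.\<close>

lemma generate_ring_subalgebra_on:
  assumes S: "S \<subseteq> carrier M" and sc: "scalars \<subseteq> S"
  shows "generate_ring (subalgebra_on M (generate_ring M S)) S = generate_ring M S"
proof -
  define B where "B = generate_ring M S"
  have M_ring: "ring M" by (rule cring.axioms(1)[OF M_cring])
  have B: "subring B M" unfolding B_def by (rule ring.generate_ring_is_subring[OF M_ring S])
  note Bs = subringE[OF B]
  have SB: "S \<subseteq> B" unfolding B_def by (auto intro: generate_ring.incl)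
  have "algebra R (subalgebra_on M B)" using algebra_subalgebra_on[OF B] sc SB by blast
  then have B_ring: "ring (subalgebra_on M B)" by (rule cring.axioms(1)[OF algebra.M_cring])
  interpret B: ring "subalgebra_on M B" by (rule B_ring)
  have "x \<in> generate_ring (subalgebra_on M B) S" if "x \<in> generate_ring M S" for x
    using that
  proof (induction rule: generate_ring.induct)
    case one
    show ?case using generate_ring.one[of "subalgebra_on M B" S] by simp
  next
    case (incl h)
    then show ?case by (rule generate_ring.incl)
  next
    case (a_inv h)
    then have h: "h \<in> B" by (simp add: B_def)
    \<comment> \<open>Negation is not a field of the record but depends on the carrier, so the
      agreement has to be proved.\<close>
    have "\<ominus>\<^bsub>subalgebra_on M B\<^esub> h = \<ominus>\<^bsub>M\<^esub> h"
      using h Bs(1,5) by (intro B.minus_equality) (auto simp: M.l_neg)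
    then show ?case using generate_ring.a_inv[OF a_inv(2)] by simp
  next
    case (eng_add h1 h2)
    show ?case using generate_ring.eng_add[OF eng_add(3,4)] by simp
  next
    case (eng_mult h1 h2)
    show ?case using generate_ring.eng_mult[OF eng_mult(3,4)] by simp
  qed
  moreover have "generate_ring (subalgebra_on M B) S \<subseteq> B"
    using B.generate_ring_incl[of S] SB by simp
  ultimately show ?thesis unfolding B_def by blast
qed

text \<open>An integral equation over the image of k can be read in \<open>B\<close> as it stands,
  because its coefficients lie in \<open>B\<close> and evaluation there is the same.\<close>

lemma etale_subalgebra_on:
  assumes k: "field R" "char_zero R" and red: "reduced M"
    and zero: "zero_module (kaehler_differentials R M)"
    and S: "finite S" "S \<subseteq> carrier M" and B: "B = generate_ring M (scalars \<union> S)"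
  shows "etale R (subalgebra_on M B)"
proof -
  have M_ring: "ring M" by (rule cring.axioms(1)[OF M_cring])
  have SM: "scalars \<union> S \<subseteq> carrier M" using S(2) by auto
  have sub: "subring B M" unfolding B by (rule ring.generate_ring_is_subring[OF M_ring SM])
  have SB: "scalars \<union> S \<subseteq> B" unfolding B by (rule subsetI, rule generate_ring.incl)
  have Bc: "B \<subseteq> carrier M" by (rule subringE(1)[OF sub])
  have alg: "algebra R (subalgebra_on M B)" using algebra_subalgebra_on[OF sub] SB by blast
  have "finite_type R (subalgebra_on M B)"
    unfolding finite_type_def
    using S(1) SB generate_ring_subalgebra_on[OF SM] by (intro exI[of _ S]) (simp add: B)
  moreover have "zero_module (kaehler_differentials R (subalgebra_on M B))"
  proof (rule algebra.zero_kaehler_if_integral[OF alg])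
    show "reduced (subalgebra_on M B)"
      using red Bc unfolding reduced_def by (auto simp: nat_pow_subalgebra_on)
    show "char_zero_field_image (subalgebra_on M B) scalars"
      using algebra.char_zero_field_image_scalars[OF alg k] by simp
    show "integral_over (subalgebra_on M B) scalars x" if "x \<in> carrier (subalgebra_on M B)" for x
      using integral_if_zero_kaehler[OF k zero, of x] that Bc
      by (auto simp: integral_over_def peval_subalgebra_on)
  qed simp
  ultimately show ?thesis using alg by (simp add: etale_def)
qed

text \<open>The transition maps are inclusions, so the limit only glues the copies of each element;
  the isomorphism sends a to the set of all its copies.\<close>

lemma directed_union_of_subalgebras:
  assumes sub: "\<And>B. B \<in> I \<Longrightarrow> subring B M" and sc: "\<And>B. B \<in> I \<Longrightarrow> scalars \<subseteq> B"
    and un: "\<Union>I = carrier M"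
    and dir: "\<And>B C. B \<in> I \<Longrightarrow> C \<in> I \<Longrightarrow> \<exists>D\<in>I. B \<subseteq> D \<and> C \<subseteq> D"
  defines "r \<equiv> {(B, C). B \<in> I \<and> C \<in> I \<and> B \<subseteq> C}"
  shows "direct_system R I r (subalgebra_on M) (\<lambda>_ _ x. x)"
    and "algebra_iso R M (direct_limit I r (subalgebra_on M) (\<lambda>_ _ x. x)) \<noteq> {}"
proof -
  have "I \<noteq> {}" using un by auto
  have "preorder_on I r" by (auto simp: preorder_on_def refl_on_def trans_def r_def)
  then have "directed_set I r"
    using \<open>I \<noteq> {}\<close> dir unfolding directed_set_def r_def by blast
  moreover have "(\<lambda>x. x) \<in> algebra_hom R (subalgebra_on M B) (subalgebra_on M C)" if "(B, C) \<in> r" for B C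
    using that by (auto simp: algebra_hom_def ring_hom_def r_def)
  ultimately show "direct_system R I r (subalgebra_on M) (\<lambda>_ _ x. x)"
    using algebra_subalgebra_on[OF sub sc] by (intro direct_system.intro) auto
  let ?E = "limit_rel I r (subalgebra_on M) (\<lambda>_ _ x. x)"
  let ?L = "direct_limit I r (subalgebra_on M) (\<lambda>_ _ x. x)"
  \<comment> \<open>Directedness is what makes two copies of x equivalent: a member containing both
    subalgebras is needed.\<close>
  have E: "?E = {((B, x), (C, y)). B \<in> I \<and> x \<in> B \<and> C \<in> I \<and> y \<in> C \<and> x = y}"
    (is "_ = ?E'")
  proof
    show "?E \<subseteq> ?E'" unfolding limit_rel_def by auto
    show "?E' \<subseteq> ?E"
    proof
      fix p assume "p \<in> ?E'"
      then obtain B C x where p: "p = ((B, x), (C, x))" "B \<in> I" "x \<in> B" "C \<in> I" "x \<in> C" by auto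
      then obtain D where "D \<in> I" "B \<subseteq> D" "C \<subseteq> D" using dir by blast
      then have "(B, D) \<in> r" "(C, D) \<in> r" using p by (auto simp: r_def)
      then show "p \<in> ?E" using p unfolding limit_rel_def by auto
    qed
  qed
  define cls where "cls a = {(B, a) | B. B \<in> I \<and> a \<in> B}" for a
  \<comment> \<open>Any nonempty set of copies of a generates the full class of a. Every operation
    of the limit is the closure of such a set, so this one fact evaluates them all.\<close>
  have image: "?E `` X = cls a"
    if ne: "X \<noteq> {}" and X: "\<And>p. p \<in> X \<Longrightarrow> \<exists>B\<in>I. a \<in> B \<and> p = (B, a)" for X a
  proof
    show "?E `` X \<subseteq> cls a"
    proof
      fix q assume "q \<in> ?E `` X"
      then obtain p where p: "p \<in> X" "(p, q) \<in> ?E" by blast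
      then obtain B where "p = (B, a)" using X by blast
      then show "q \<in> cls a" using p(2) unfolding E cls_def by auto
    qed
    obtain p where "p \<in> X" using ne by blast
    then obtain B where "(B, a) \<in> X" "B \<in> I" "a \<in> B" using X by blast
    then show "cls a \<subseteq> ?E `` X" unfolding E cls_def by blast
  qed
  have ex: "\<exists>B\<in>I. a \<in> B" if "a \<in> carrier M" for a using that un by blast
  have carr: "cls a \<in> carrier ?L" if a: "a \<in> carrier M" for a
  proof -
    obtain B where B: "B \<in> I" "a \<in> B" using ex[OF a] by blast
    then have "?E `` {(B, a)} = cls a" by (intro image) auto
    moreover have "(B, a) \<in> (SIGMA i:I. carrier (subalgebra_on M i))" using B by simp
    ultimately show ?thesis unfolding direct_limit_def by (auto simp: quotient_def)
  qed
  have op: "limit_op I r (subalgebra_on M) (\<lambda>_ _ x. x) (\<lambda>_. f) (cls a) (cls b) = cls (f a b)"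
    if a: "a \<in> carrier M" and b: "b \<in> carrier M" and f: "\<And>B. B \<in> I \<Longrightarrow> a \<in> B \<Longrightarrow> b \<in> B \<Longrightarrow> f a b \<in> B" for a b f
    unfolding limit_op_def
  proof (rule image)
    obtain B C where BC: "B \<in> I" "a \<in> B" "C \<in> I" "b \<in> C" using ex[OF a] ex[OF b] by blast
    then obtain D where "D \<in> I" "B \<subseteq> D" "C \<subseteq> D" using dir by blast
    then have "(B, a) \<in> cls a \<and> (C, b) \<in> cls b \<and> (B, D) \<in> r \<and> (C, D) \<in> r" using BC by (auto simp: cls_def r_def)
    then show "{(l, f x y) |i x j y l. (i, x) \<in> cls a \<and> (j, y) \<in> cls b \<and> (i, l) \<in> r \<and> (j, l) \<in> r} \<noteq> {}"
      by blast
  next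
    fix p assume "p \<in> {(l, f x y) |i x j y l. (i, x) \<in> cls a \<and> (j, y) \<in> cls b \<and> (i, l) \<in> r \<and> (j, l) \<in> r}"
    then obtain B C D where "p = (D, f a b)" "B \<in> I" "a \<in> B" "C \<in> I" "b \<in> C" "(B, D) \<in> r" "(C, D) \<in> r"
      by (auto simp: cls_def)
    then show "\<exists>B\<in>I. f a b \<in> B \<and> p = (B, f a b)" using f[of D] by (auto simp: r_def)
  qed
  have "cls \<in> algebra_hom R M ?L"
    unfolding algebra_hom_def
  proof (intro CollectI conjI ballI ring_hom_memI)
    show "cls a \<in> carrier ?L" if "a \<in> carrier M" for a by (rule carr[OF that])
  next
    fix a b assume a: "a \<in> carrier M" and b: "b \<in> carrier M"
    show "cls (a \<otimes>\<^bsub>M\<^esub> b) = cls a \<otimes>\<^bsub>?L\<^esub> cls b"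
      using op[OF a b, of "mult M"] subringE(6)[OF sub] by (simp add: direct_limit_def)
    show "cls (a \<oplus>\<^bsub>M\<^esub> b) = cls a \<oplus>\<^bsub>?L\<^esub> cls b"
      using op[OF a b, of "add M"] subringE(7)[OF sub] by (simp add: direct_limit_def)
  next
    have "?E `` {(B, \<one>\<^bsub>M\<^esub>) |B. B \<in> I} = cls \<one>\<^bsub>M\<^esub>"
      using \<open>I \<noteq> {}\<close> subringE(3)[OF sub] by (intro image) auto
    then show "cls \<one>\<^bsub>M\<^esub> = \<one>\<^bsub>?L\<^esub>" by (simp add: direct_limit_def)
  next
    fix c a assume c: "c \<in> carrier R" and a: "a \<in> carrier M"
    have "?E `` {(B, c \<odot>\<^bsub>M\<^esub> x) |B x. (B, x) \<in> cls a} = cls (c \<odot>\<^bsub>M\<^esub> a)"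
    proof (rule image)
      show "{(B, c \<odot>\<^bsub>M\<^esub> x) |B x. (B, x) \<in> cls a} \<noteq> {}" using ex[OF a] by (auto simp: cls_def)
      fix p assume "p \<in> {(B, c \<odot>\<^bsub>M\<^esub> x) |B x. (B, x) \<in> cls a}"
      then obtain B where B: "p = (B, c \<odot>\<^bsub>M\<^esub> a)" "B \<in> I" "a \<in> B" by (auto simp: cls_def)
      interpret B: algebra R "subalgebra_on M B" by (rule algebra_subalgebra_on[OF sub[OF B(2)] sc[OF B(2)]])
      show "\<exists>B\<in>I. c \<odot>\<^bsub>M\<^esub> a \<in> B \<and> p = (B, c \<odot>\<^bsub>M\<^esub> a)" using B.smult_closed[OF c, of a] B by auto
    qed
    then show "cls (c \<odot>\<^bsub>M\<^esub> a) = c \<odot>\<^bsub>?L\<^esub> cls a" by (simp add: direct_limit_def)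
  qed
  moreover have "inj_on cls (carrier M)"
  proof (rule inj_onI)
    fix a b assume a: "a \<in> carrier M" and eq: "cls a = cls b"
    obtain B where "B \<in> I" "a \<in> B" using ex[OF a] by blast
    then have "(B, a) \<in> cls a" by (simp add: cls_def)
    then show "a = b" unfolding eq by (simp add: cls_def)
  qed
  moreover have "carrier ?L \<subseteq> cls ` carrier M"
  proof
    fix U assume "U \<in> carrier ?L"
    then obtain B a where B: "B \<in> I" "a \<in> B" "U = ?E `` {(B, a)}"
      by (auto simp: direct_limit_def quotient_def)
    have "U = cls a" unfolding B(3) by (rule image) (use B(1,2) in auto)
    moreover have "a \<in> carrier M" using B(1,2) un by blast
    ultimately show "U \<in> cls ` carrier M" by blast
  qed
  ultimately have "cls \<in> algebra_iso R M ?L"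
    using carr by (auto simp: algebra_iso_def bij_betw_def)
  then show "algebra_iso R M ?L \<noteq> {}" by blast
qed

end

theorem theorem1p3:
  fixes k :: "('k, 'm) ring_scheme" and A :: "('k, 'a, 'n) module_scheme"
  assumes "field k" and "char_zero k"
    and "algebra k A" and "reduced A"
    and "zero_module (kaehler_differentials k A)"
  shows "ind_etale TYPE('a set) TYPE('a) k A"
proof -
  interpret algebra k A by (rule assms(3))
  have ring: "ring A" by (rule cring.axioms(1)[OF M_cring])
  let ?K = "(\<lambda>c. c \<odot>\<^bsub>A\<^esub> \<one>\<^bsub>A\<^esub>) ` carrier k"
  let ?gen = "\<lambda>S. generate_ring A (?K \<union> S)"
  \<comment> \<open>Subalgebras serve as their own indices, ordered by inclusion; this fixes the
    index type as \<open>'a set\<close> and identifies different generating sets of one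
    subalgebra.\<close>
  define I where "I = {?gen S | S. finite S \<and> S \<subseteq> carrier A}"
  have KS: "?K \<union> S \<subseteq> carrier A" if "S \<subseteq> carrier A" for S using that by auto
  have gen: "subring (?gen S) A" "?K \<union> S \<subseteq> ?gen S" if "S \<subseteq> carrier A" for S
    using ring.generate_ring_is_subring[OF ring KS[OF that]] by (auto intro: generate_ring.incl)
  have sub: "subring B A" and sc: "?K \<subseteq> B" if "B \<in> I" for B
    using that gen unfolding I_def by blast+
  have un: "\<Union>I = carrier A"
  proof
    show "\<Union>I \<subseteq> carrier A" using subringE(1)[OF sub] by blast
    show "carrier A \<subseteq> \<Union>I"
    proof
      fix a assume a: "a \<in> carrier A"
      then have "?gen {a} \<in> I" unfolding I_def by blast
      moreover have "a \<in> ?gen {a}" using gen(2)[of "{a}"] a by blast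
      ultimately show "a \<in> \<Union>I" by blast
    qed
  qed
  have dir: "\<exists>D\<in>I. B \<subseteq> D \<and> C \<subseteq> D" if BC: "B \<in> I" "C \<in> I" for B C
  proof -
    obtain S T where S: "B = ?gen S" "finite S" "S \<subseteq> carrier A"
      and T: "C = ?gen T" "finite T" "T \<subseteq> carrier A" using BC unfolding I_def by blast
    have ST: "S \<union> T \<subseteq> carrier A" using S T by blast
    then have "?gen (S \<union> T) \<in> I" unfolding I_def using S(2) T(2) by blast
    moreover have "B \<subseteq> ?gen (S \<union> T)" "C \<subseteq> ?gen (S \<union> T)"
      unfolding S(1) T(1) by (rule ring.mono_generate_ring[OF ring _ KS[OF ST]], blast)+
    ultimately show ?thesis by blast
  qed
  have "etale k (subalgebra_on A B)" if "B \<in> I" for B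
    using that etale_subalgebra_on[OF assms(1,2,4,5)] unfolding I_def by blast
  then show ?thesis
    using directed_union_of_subalgebras[OF sub sc un dir] unfolding ind_etale_def by blast
qed

end
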